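(* Let $f$, $x_1<x_2$, $\nu>0$ and $g$ be as in the context, and let $x^\circ(t)=\arg\min_{x_1\le x\le x_2}\{f(x+t)+g(x)\}$ be the specific piecewise linear (possibly discontinuous) minimizer function described in the context, with associated $Q$, $t^\star_1,\dots,t^\star_Q$, index map $l$, and indices $a_1,\dots,a_{|A|}$. Then the function $$h(t)=f\big(x^\circ(t)+t\big)+g\big(x^\circ(t)\big)$$ is a continuous, nondecreasing, piecewise linear function of $t\in\mathbb{R}$, such that: $h(t)=f(x_2+t)$ for all $t$ with $x^\circ(t)=x_2$; $h(t)$ is a linear segment with slope $\nu$ wherever $x^\circ(t)$ decreases with slope $-1$, the vertical alignments of these segments being such that $h$ is continuous; and $h(t)=f(x_1+t)+\nu(x_2-x_1)$ for all $t$ with $x^\circ(t)=x_1$. Explicitly: - If $Q=0$: $$h(t)=\begin{cases} f(x_2+t) & \text{if } x^\circ(t)=x_2\\ \nu t+\big[f(\gamma_{a_1})-\nu(\gamma_{a_1}-x_2)\big] & \text{if } x^\circ(t)\notin\{x_1,x_2\}\\ f(x_1+t)+\nu(x_2-x_1) & \text{if } x^\circ(t)=x_1.\end{cases}$$ - If $Q=1$: $$h(t)=\begin{cases} f(x_2+t) & \text{if } x^\circ(t)=x_2\\ \nu t+\big[f(\gamma_{a_1})-\nu(\gamma_{a_1}-x_2)\big] & \text{if } t<t^\star_1,\ x^\circ(t)\notin\{x_1,x_2\}\\ \nu t+\big[f(\gamma_{a_{l(Q)+1}})-\nu(\gamma_{a_{l(Q)+1}}-x_2)\big] & \text{if } t\ge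 t^\star_1,\ x^\circ(t)\notin\{x_1,x_2\}\\ f(x_1+t)+\nu(x_2-x_1) & \text{if } x^\circ(t)=x_1.\end{cases}$$ - If $Q>1$: $$h(t)=\begin{cases} f(x_2+t) & \text{if } x^\circ(t)=x_2\\ \nu t+\big[f(\gamma_{a_1})-\nu(\gamma_{a_1}-x_2)\big] & \text{if } t<t^\star_1,\ x^\circ(t)\notin\{x_1,x_2\}\\ \nu t+\big[f(\gamma_{a_{l(q)+1}})-\nu(\gamma_{a_{l(q)+1}}-x_2)\big] & \text{if } t\in[t^\star_q,t^\star_{q+1}),\ x^\circ(t)\notin\{x_1,x_2\},\ q=1,\dots,Q-1\\ \nu t+\big[f(\gamma_{a_{l(Q)+1}})-\nu(\gamma_{a_{l(Q)+1}}-x_2)\big] & \text{if } t\ge t^\star_Q,\ x^\circ(t)\notin\{x_1,x_2\}\\ f(x_1+t)+\nu(x_2-x_1) & \text{if } x^\circ(t)=x_1.\end{cases}$$ (When $l(Q)=|A|$ there is no $t\ge t^\star_Q$ with $x^\circ(t)\notin\{x_1,x_2\}$, so the line involving $\gamma_{a_{l(Q)+1}}$ — respectively $\gamma_{a_1}$ for $Q=0$ — is void.)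
   Context: **The function $f$.** $f:\mathbb{R}\to\mathbb{R}$ is continuous, nondecreasing and piecewise linear with $M\ge1$ changes of slope, at abscissae $\gamma_1<\gamma_2<\dots<\gamma_M$. Its slope is $\mu_0$ on $(-\infty,\gamma_1)$, $\mu_i$ on $[\gamma_i,\gamma_{i+1})$ for $i=1,\dots,M-1$, and $\mu_M$ on $[\gamma_M,+\infty)$, with $\mu_{i+1}\ne\mu_i$ for $i=0,\dots,M-1$. Moreover $f(x)=0$ for all $x\le\gamma_1$, so $\mu_0=0$. **The function $g$.** For $x_1<x_2$ and $\nu>0$: $g(x)=-\nu(x-x_2)$ for $x\in[x_1,x_2)$ and $g(x)=0$ for $x\notin[x_1,x_2)$. **The sets $A$, $B$.** $A$ is the set of $i\in\{1,\dots,M\}$ with $\mu_{i-1}<\nu$ and $\mu_i\ge\nu$; its elements in increasing order are $a_1,\dots,a_{|A|}$. $B$ is the set of $i\in\{1,\dots,M\}$ with $\mu_{i-1}\ge\nu$ and $\mu_i<\nu$; its elements in increasing order are $b_1,\dots,b_{|B|}$. (Since $\mu_0=0<\nu$: $a_j<b_j$ for $j\le|B|$, $b_j<a_{j+1}$ for $j\le|A|-1$, and $|A|\in\{|B|,|B|+1\}$.) **The minimizer function $x^\circ$.** If $|B|\ge 1$, let $\omega_1,\dots,\omega_{|B|}\in\mathbb{R}\cup\{+\infty\}$ be the values produced by the algorithm below, let $t^\star_1,\dots,t^\star_Q$ be the finite ones, listed in order of increasing index $j$, and let $l(q)$ be the index $j$ with $\omega_j=t^\star_q$. If $|B|=0$,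 let $Q=0$. Set $l(0)=0$, and $t^\star_Q=-\infty$ when $Q=0$. It is known that $l(Q)=|B|$ and that for every $t$ the following value $x^\circ(t)$ minimizes $f(x+t)+g(x)$ over $x\in[x_1,x_2]$: - if $Q=0$: $x^\circ(t)=x_{\mathrm e}(t)$ for all $t$; - if $Q\ge1$: $x^\circ(t)=x_{\mathrm s}(t)$ for $t<t^\star_1$; $x^\circ(t)=x_q(t)$ for $t^\star_q\le t<t^\star_{q+1}$, $q=1,\dots,Q-1$; $x^\circ(t)=x_{\mathrm e}(t)$ for $t\ge t^\star_Q$. Here: - $x_{\mathrm s}(t)$: if $t^\star_1>\gamma_{a_1}-x_1$, it equals $x_2$ for $t<\gamma_{a_1}-x_2$, $-t+\gamma_{a_1}$ for $\gamma_{a_1}-x_2\le t<\gamma_{a_1}-x_1$, $x_1$ for $\gamma_{a_1}-x_1\le t<t^\star_1$; if $t^\star_1\le\gamma_{a_1}-x_1$, it equals $x_2$ for $t<\gamma_{a_1}-x_2$ and $-t+\gamma_{a_1}$ for $\gamma_{a_1}-x_2\le t<t^\star_1$. - $x_q(t)$, with $\Gamma_q=\gamma_{a_{l(q)+1}}$: if $t^\star_q<\Gamma_q-x_2$ and $t^\star_{q+1}>\Gamma_q-x_1$, it equals $x_2$ for $t^\star_q\le t<\Gamma_q-x_2$, $-t+\Gamma_q$ for $\Gamma_q-x_2\le t<\Gamma_q-x_1$, $x_1$ for $\Gamma_q-x_1\le t<t^\star_{q+1}$; if $t^\star_q\ge\Gamma_q-x_2$ and $t^\star_{q+1}>\Gamma_q-x_1$,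 it equals $-t+\Gamma_q$ for $t^\star_q\le t<\Gamma_q-x_1$ and $x_1$ for $\Gamma_q-x_1\le t<t^\star_{q+1}$; if $t^\star_q<\Gamma_q-x_2$ and $t^\star_{q+1}\le\Gamma_q-x_1$, it equals $x_2$ for $t^\star_q\le t<\Gamma_q-x_2$ and $-t+\Gamma_q$ for $\Gamma_q-x_2\le t<t^\star_{q+1}$; if $t^\star_q\ge\Gamma_q-x_2$ and $t^\star_{q+1}\le\Gamma_q-x_1$, it equals $-t+\Gamma_q$. - $x_{\mathrm e}(t)$: if $l(Q)<|A|$, with $\Gamma_Q=\gamma_{a_{l(Q)+1}}$: when $t^\star_Q<\Gamma_Q-x_2$ it equals $x_2$ for $t^\star_Q\le t<\Gamma_Q-x_2$, $-t+\Gamma_Q$ for $\Gamma_Q-x_2\le t<\Gamma_Q-x_1$, $x_1$ for $t\ge\Gamma_Q-x_1$; when $t^\star_Q\ge\Gamma_Q-x_2$ it equals $-t+\Gamma_Q$ for $t^\star_Q\le t<\Gamma_Q-x_1$ and $x_1$ for $t\ge\Gamma_Q-x_1$. If $l(Q)=|A|$: $x_{\mathrm e}(t)=x_2$. **Algorithm (computes $\omega_j$ for a given $j\in\{1,\dots,|B|\}$).** Variables are updated by assignment ($:=$); empty "for" ranges do nothing. *Section A (initialization).* Put $\gamma_0:=-\infty$; let $h\ge0$ be such that $\gamma_h\le\gamma_{b_j}-(x_2-x_1)<\gamma_{h+1}$ (here $h$ is an index, unrelated to the function $h(t)$ of the claim); $i:=b_j$; $\gamma_{M+1}:=+\infty$;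 let $k\le M$ be such that $\gamma_k<\gamma_{b_j}+(x_2-x_1)\le\gamma_{k+1}$. If $j=|B|$ and $|A|=|B|$, put $a_{j+1}:=M+1$ (within the algorithm only). For $p=h,\dots,k$ put $\tilde\mu_p:=\mu_p-\nu$. Put $\tau:=\gamma_{b_j}-(x_2-x_1)$, $\theta:=\gamma_{b_j}$, $d:=\max\{0,\tilde\mu_h(\gamma_{h+1}-\tau)\}$. If $h<b_j-1$, then for $p=h+1,\dots,b_j-1$ (in order) $d:=\max\{0,d+\tilde\mu_p(\gamma_{p+1}-\gamma_p)\}$. Put $\lambda:=h$, $\xi:=i$. *Section B (first loop).* While $h<b_j$ and $i<a_{j+1}$ do: 1. $\psi:=\min\{\gamma_{h+1}-\tau,\ \gamma_{i+1}-\theta\}$. 2. If $\gamma_{h+1}-\tau\le\gamma_{i+1}-\theta$, put $\lambda:=h+1$. If $\gamma_{h+1}-\tau\ge\gamma_{i+1}-\theta$, put $\xi:=i+1$. 3. $\delta:=\max\{0,\tilde\mu_\lambda[\gamma_{\lambda+1}-(\tau+\psi)]\}$. If $\lambda<b_j-1$, then for $p=\lambda+1,\dots,b_j-1$ (in order) $\delta:=\max\{0,\delta+\tilde\mu_p(\gamma_{p+1}-\gamma_p)\}$. 4. If $\xi=b_j$: $\delta:=\delta+\tilde\mu_\xi[(\theta+\psi)-\gamma_\xi]$. Else if $\xi=a_{j+1}$: $\delta:=\delta+\sum_{p=b_j}^{\xi-1}\tilde\mu_p(\gamma_{p+1}-\gamma_p)$. Else: $\delta:=\delta+\sum_{p=b_j}^{\xi-1}\tilde\mu_p(\gamma_{p+1}-\gamma_p)+\tilde\mu_\xi[(\theta+\psi)-\gamma_\xi]$.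 5. If $\delta\le0$: put $a_0:=0$ and let $r\ge1$ be such that $a_{r-1}\le h<a_r$. - If $r\le j$: for each $q=r,\dots,j$ let $\chi_q:=\tilde\mu_h(\gamma_{h+1}-\tau)$, plus $\sum_{p=h+1}^{a_q-1}\tilde\mu_p(\gamma_{p+1}-\gamma_p)$ if $h<a_q-1$; let $m:=\min_{r\le q\le j}\chi_q$. If $m\le0$, output $\omega_j:=\tau-x_1-\frac{d}{\tilde\mu_i}$ and stop. Else if $-\frac{d-m}{\tilde\mu_i}\le\frac{m}{\tilde\mu_h}$, output $\omega_j:=\tau-x_1+\frac{d}{\tilde\mu_h-\tilde\mu_i}$ and stop. Else output $\omega_j:=\tau-x_1-\frac{d-m}{\tilde\mu_i}$ and stop. - If $r>j$: output $\omega_j:=\tau-x_1+\frac{d}{\tilde\mu_h-\tilde\mu_i}$ and stop. 6. If $\delta>0$: $h:=\lambda$, $i:=\xi$, $\tau:=\tau+\psi$, $\theta:=\theta+\psi$, $d:=\delta$. *Section C (second loop, entered if Section B ends without output).* While $h<b_j$ do: 1. $\psi:=\gamma_{h+1}-\tau$; $\lambda:=h+1$. 2. If $\lambda<b_j$: $\delta:=\max\{0,\tilde\mu_\lambda[\gamma_{\lambda+1}-(\tau+\psi)]\}$ and, if $\lambda<b_j-1$, for $p=\lambda+1,\dots,b_j-1$ (in order) $\delta:=\max\{0,\delta+\tilde\mu_p(\gamma_{p+1}-\gamma_p)\}$. Otherwise $\delta:=0$. 3. $\delta:=\delta+\sum_{p=b_j}^{a_{j+1}-1}\tilde\mu_p(\gamma_{p+1}-\gamma_p)$.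 4. If $\delta\le0$: put $\tau:=\tau+\frac{d}{\tilde\mu_h}$, $\theta:=\tau+(x_2-x_1)$; let $k\le M$ be such that $\gamma_k<\theta\le\gamma_{k+1}$; put $r:=a_{j+1}$, $\phi:=0$. While $r\le k$: put $\phi:=\phi+\tilde\mu_r(\gamma_{r+1}-\gamma_r)$ if $r<k$, and $\phi:=\phi+\tilde\mu_r(\theta-\gamma_r)$ if $r=k$; if $\phi<0$, output $\omega_j:=+\infty$ and stop; otherwise $r:=r+1$. If this inner loop ends without output, output $\omega_j:=\tau-x_1$ and stop. 5. If $\delta>0$: $h:=\lambda$, $\tau:=\tau+\psi$, $d:=\delta$. *)

theory Defs
  imports "HOL-Analysis.Analysis"
begin

text \<open>
  Breakpoints are functions \<open>nat \<Rightarrow> real\<close> used at the indices \<open>1..N\<close>; \<open>ext_bp\<close> adds the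
  conventions \<open>\<gamma>\<^sub>0 = -\<infinity>\<close> and \<open>\<gamma>\<^bsub>N+1\<^esub> = +\<infinity>\<close>.
\<close>

definition ext_bp :: "nat \<Rightarrow> (nat \<Rightarrow> real) \<Rightarrow> nat \<Rightarrow> ereal" where
  "ext_bp N \<gamma> p = (if p = 0 then -\<infinity> else if p \<le> N then ereal (\<gamma> p) else \<infinity>)"

definition has_slope_on :: "(real \<Rightarrow> real) \<Rightarrow> real \<Rightarrow> real set \<Rightarrow> bool" where
  "has_slope_on f m S \<longleftrightarrow> (\<exists>c. \<forall>x\<in>S. f x = m * x + c)"

text \<open>Continuity is not part of this notion; the pieces are closed on the left and open on the right.\<close>

definition pl_with :: "(real \<Rightarrow> real) \<Rightarrow> nat \<Rightarrow> (nat \<Rightarrow> real) \<Rightarrow> (nat \<Rightarrow> real) \<Rightarrow> bool" where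
  "pl_with f N \<gamma> \<mu> \<longleftrightarrow> strict_mono_on {1..N} \<gamma> \<and>
     (\<forall>i\<le>N. has_slope_on f (\<mu> i) {x. ext_bp N \<gamma> i \<le> ereal x \<and> ereal x < ext_bp N \<gamma> (i + 1)})"

definition piecewise_linear :: "(real \<Rightarrow> real) \<Rightarrow> bool" where
  "piecewise_linear f \<longleftrightarrow> (\<exists>N \<gamma> \<mu>. pl_with f N \<gamma> \<mu>)"

definition ramp :: "real \<Rightarrow> real \<Rightarrow> real \<Rightarrow> real \<Rightarrow> real" where
  "ramp x1 x2 \<nu> x = (if x1 \<le> x \<and> x < x2 then - \<nu> * (x - x2) else 0)"

locale pl_setting =
  fixes M :: nat and \<gamma> \<mu> :: "nat \<Rightarrow> real" and \<nu> x1 x2 :: real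
begin

definition up_set :: "nat set" where
  "up_set = {i \<in> {1..M}. \<mu> (i - 1) < \<nu> \<and> \<nu> \<le> \<mu> i}"

definition down_set :: "nat set" where
  "down_set = {i \<in> {1..M}. \<nu> \<le> \<mu> (i - 1) \<and> \<mu> i < \<nu>}"

text \<open>\<open>a j\<close> and \<open>b j\<close> are the \<open>j\<close>-th smallest elements, counted from \<open>j = 1\<close>.\<close>

definition a :: "nat \<Rightarrow> nat" where
  "a j = sorted_list_of_set up_set ! (j - 1)"

definition b :: "nat \<Rightarrow> nat" where
  "b j = sorted_list_of_set down_set ! (j - 1)"

text \<open>
  The algorithm computing \<open>\<omega>\<^sub>j\<close> is carried out in the extended reals, because of the breakpoints
  \<open>\<gamma>\<^sub>0\<close> and \<open>\<gamma>\<^bsub>M+1\<^esub>\<close>, and because the quotient \<open>m / \<mu>t h\<close> in \<open>first_output\<close> is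
  evaluated with \<open>m > 0\<close> and possibly \<open>\<mu>t h = 0\<close>, where it has to be read as \<open>+\<infinity>\<close>
  (which is what division on \<^typ>\<open>ereal\<close> yields).
\<close>

abbreviation \<Gamma> :: "nat \<Rightarrow> ereal" where
  "\<Gamma> \<equiv> ext_bp M \<gamma>"

definition \<mu>t :: "nat \<Rightarrow> ereal" where
  "\<mu>t p = ereal (\<mu> p - \<nu>)"

definition alg_a :: "nat \<Rightarrow> nat \<Rightarrow> nat" where
  "alg_a j q =
     (if q = 0 then 0
      else if q = j + 1 \<and> j = card down_set \<and> card up_set = card down_set then M + 1
      else a q)"

definition seg_sum :: "nat \<Rightarrow> nat \<Rightarrow> ereal" where
  "seg_sum lo hi = (\<Sum>p\<in>{lo..<hi}. \<mu>t p * (\<Gamma> (p + 1) - \<Gamma> p))"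

text \<open>
  Start with \<open>max 0 (\<mu>t h * (\<Gamma> (h + 1) - \<tau>))\<close> and update it successively for
  \<open>p = h + 1, \<dots>, b j - 1\<close>.
\<close>

definition left_part :: "nat \<Rightarrow> nat \<Rightarrow> ereal \<Rightarrow> ereal" where
  "left_part j h \<tau> =
     fold (\<lambda>p d. max 0 (d + \<mu>t p * (\<Gamma> (p + 1) - \<Gamma> p))) [h + 1..<b j]
       (max 0 (\<mu>t h * (\<Gamma> (h + 1) - \<tau>)))"

definition right_part :: "nat \<Rightarrow> nat \<Rightarrow> ereal \<Rightarrow> ereal" where
  "right_part j \<xi> \<theta> =
     (if \<xi> = b j then \<mu>t \<xi> * (\<theta> - \<Gamma> \<xi>)
      else if \<xi> = alg_a j (j + 1) then seg_sum (b j) \<xi>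
      else seg_sum (b j) \<xi> + \<mu>t \<xi> * (\<theta> - \<Gamma> \<xi>))"

definition first_output :: "nat \<Rightarrow> nat \<Rightarrow> nat \<Rightarrow> ereal \<Rightarrow> ereal \<Rightarrow> ereal" where
  "first_output j h i \<tau> d =
     (let r = (THE r. r \<in> {1..j + 1} \<and> alg_a j (r - 1) \<le> h \<and> h < alg_a j r) in
      if r \<le> j then
        (let chi = (\<lambda>q. \<mu>t h * (\<Gamma> (h + 1) - \<tau>) + seg_sum (h + 1) (a q));
             m = Min (chi ` {r..j}) in
         if m \<le> 0 then \<tau> - ereal x1 - d / \<mu>t i
         else if - ((d - m) / \<mu>t i) \<le> m / \<mu>t h then \<tau> - ereal x1 + d / (\<mu>t h - \<mu>t i)
         else \<tau> - ereal x1 - (d - m) / \<mu>t i)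
      else \<tau> - ereal x1 + d / (\<mu>t h - \<mu>t i))"

text \<open>Innermost loop: does the accumulated \<open>\<phi>\<close> become negative for some index up to \<open>k\<close>?\<close>

function overtaken :: "ereal \<Rightarrow> nat \<Rightarrow> nat \<Rightarrow> ereal \<Rightarrow> bool" where
  "overtaken \<theta> k r \<phi> =
     (if r \<le> k then
        (let \<phi>' = \<phi> + (if r < k then \<mu>t r * (\<Gamma> (r + 1) - \<Gamma> r) else \<mu>t r * (\<theta> - \<Gamma> r)) in
         if \<phi>' < 0 then True else overtaken \<theta> k (r + 1) \<phi>')
      else False)"
  by pat_completeness auto
termination by (relation "Wellfounded.measure (\<lambda>(\<theta>, k, r, \<phi>). Suc k - r)") auto

definition second_output :: "nat \<Rightarrow> nat \<Rightarrow> ereal \<Rightarrow> ereal \<Rightarrow> ereal" where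
  "second_output j h \<tau> d =
     (let \<tau>' = \<tau> + d / \<mu>t h;
          \<theta> = \<tau>' + ereal (x2 - x1);
          k = (THE k. k \<le> M \<and> \<Gamma> k < \<theta> \<and> \<theta> \<le> \<Gamma> (k + 1)) in
      if overtaken \<theta> k (alg_a j (j + 1)) 0 then \<infinity> else \<tau>' - ereal x1)"

text \<open>The value \<^const>\<open>undefined\<close> stands for leaving the second loop without output.\<close>

function second_loop :: "nat \<Rightarrow> nat \<Rightarrow> ereal \<Rightarrow> ereal \<Rightarrow> ereal" where
  "second_loop j h \<tau> d =
     (if h < b j then
        (let \<psi> = \<Gamma> (h + 1) - \<tau>;
             lam = h + 1;
             \<delta> = (if lam < b j then left_part j lam (\<tau> + \<psi>) else 0)
                   + seg_sum (b j) (alg_a j (j + 1)) in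
         if \<delta> \<le> 0 then second_output j h \<tau> d
         else second_loop j lam (\<tau> + \<psi>) \<delta>)
      else undefined)"
  by pat_completeness auto
termination by (relation "Wellfounded.measure (\<lambda>(j, h, \<tau>, d). b j - h)") auto

function first_loop :: "nat \<Rightarrow> nat \<Rightarrow> nat \<Rightarrow> ereal \<Rightarrow> ereal \<Rightarrow> ereal \<Rightarrow> ereal" where
  "first_loop j h i \<tau> \<theta> d =
     (if h < b j \<and> i < alg_a j (j + 1) then
        (let \<psi> = min (\<Gamma> (h + 1) - \<tau>) (\<Gamma> (i + 1) - \<theta>);
             lam = (if \<Gamma> (h + 1) - \<tau> \<le> \<Gamma> (i + 1) - \<theta> then h + 1 else h);
             \<xi> = (if \<Gamma> (h + 1) - \<tau> \<ge> \<Gamma> (i + 1) - \<theta> then i + 1 else i);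
             \<delta> = left_part j lam (\<tau> + \<psi>) + right_part j \<xi> (\<theta> + \<psi>) in
         if \<delta> \<le> 0 then first_output j h i \<tau> d
         else first_loop j lam \<xi> (\<tau> + \<psi>) (\<theta> + \<psi>) \<delta>)
      else second_loop j h \<tau> d)"
  by pat_completeness auto
termination
  by (relation "Wellfounded.measure (\<lambda>(j, h, i, \<tau>, \<theta>, d). (b j - h) + (alg_a j (j + 1) - i))") auto

declare overtaken.simps [simp del] second_loop.simps [simp del] first_loop.simps [simp del]

definition \<omega> :: "nat \<Rightarrow> ereal" where
  "\<omega> j =
     (let \<tau> = ereal (\<gamma> (b j) - (x2 - x1));
          h = (THE h. \<Gamma> h \<le> \<tau> \<and> \<tau> < \<Gamma> (h + 1)) in
      first_loop j h (b j) \<tau> (ereal (\<gamma> (b j))) (left_part j h \<tau>))"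

definition finite_idx :: "nat list" where
  "finite_idx = filter (\<lambda>j. \<bar>\<omega> j\<bar> \<noteq> \<infinity>) [1..<card down_set + 1]"

definition Q :: nat where
  "Q = length finite_idx"

definition l :: "nat \<Rightarrow> nat" where
  "l q = (if q = 0 then 0 else finite_idx ! (q - 1))"

text \<open>The value at \<open>0\<close> is only used when \<open>Q = 0\<close>.\<close>

definition tstar :: "nat \<Rightarrow> ereal" where
  "tstar q = (if q = 0 then -\<infinity> else \<omega> (l q))"

definition x_s :: "real \<Rightarrow> real" where
  "x_s t =
     (if tstar 1 > ereal (\<gamma> (a 1) - x1) then
        (if t < \<gamma> (a 1) - x2 then x2
         else if t < \<gamma> (a 1) - x1 then - t + \<gamma> (a 1)
         else x1)
      else
        (if t < \<gamma> (a 1) - x2 then x2 else - t + \<gamma> (a 1)))"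

definition x_mid :: "nat \<Rightarrow> real \<Rightarrow> real" where
  "x_mid q t =
     (let G = \<gamma> (a (l q + 1)) in
      if tstar q < ereal (G - x2) \<and> tstar (q + 1) > ereal (G - x1) then
        (if t < G - x2 then x2 else if t < G - x1 then - t + G else x1)
      else if tstar q \<ge> ereal (G - x2) \<and> tstar (q + 1) > ereal (G - x1) then
        (if t < G - x1 then - t + G else x1)
      else if tstar q < ereal (G - x2) \<and> tstar (q + 1) \<le> ereal (G - x1) then
        (if t < G - x2 then x2 else - t + G)
      else - t + G)"

definition x_e :: "real \<Rightarrow> real" where
  "x_e t =
     (if l Q < card up_set then
        (let G = \<gamma> (a (l Q + 1)) in
         if tstar Q < ereal (G - x2) then
           (if t < G - x2 then x2 else if t < G - x1 then - t + G else x1)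
         else
           (if t < G - x1 then - t + G else x1))
      else x2)"

definition x_circ :: "real \<Rightarrow> real" where
  "x_circ t =
     (if Q = 0 then x_e t
      else if ereal t < tstar 1 then x_s t
      else if tstar Q \<le> ereal t then x_e t
      else x_mid (THE q. q \<in> {1..<Q} \<and> tstar q \<le> ereal t \<and> ereal t < tstar (q + 1)) t)"

end

end

theory Submission
  imports Defs
begin

text \<open>
  Put \<open>F y = f y - \<nu> y\<close>. With \<open>s = t + x1\<close> and \<open>L = x2 - x1\<close>, the problem is to minimize
  \<open>F\<close> over the sliding window \<open>[s, s + L]\<close>. The valleys of \<open>F\<close> are the breakpoints with an index
  \<open>a\<^sub>j\<close>, its ridges those with an index \<open>b\<^sub>j\<close>. For each ridge, let \<open>gap j s\<close> be the value of \<open>F\<close>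
  at the last point of the descent from the ridge to the next valley that the window has reached,
  minus the minimum of \<open>F\<close> between \<open>s\<close> and the ridge. The gap decreases in \<open>s\<close>; the variable
  \<open>\<delta>\<close> of the algorithm is its value when an end of the window passes a breakpoint, and \<open>\<omega> j\<close> is its
  first zero shifted by \<open>x1\<close>, unless the window then already contains a point beyond the next
  valley that is lower than this valley, in which case \<open>\<omega> j = \<infinity>\<close>. The last finite crossing \<open>j\<close>
  not after \<open>s\<close> singles out the valley \<open>a\<^bsub>j+1\<^esub>\<close>, and the minimum over the window is attained at
  this valley clamped to the window: the leftmost minimizer to its right would lie on the descent
  from a later ridge whose crossing is also finite and not after \<open>s\<close>. Hence \<open>x_circ\<close> is a minimizer,
  and continuity and monotonicity follow by comparing minimizers.
\<close>

subsection \<open>Piecewise affine functions\<close>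

text \<open>The difference of both sides is continuous and vanishes on \<open>S\<close>, hence on
  its closure. This carries an affine formula from an open or half-open piece to the missing
  endpoints.\<close>

lemma affine_on_closure:
  fixes f :: "real \<Rightarrow> real"
  assumes "continuous_on UNIV f" "\<And>x. x \<in> S \<Longrightarrow> f x = m * x + c" "x \<in> closure S"
  shows "f x = m * x + c"
proof -
  have "continuous_on (closure S) (\<lambda>x. f x - m * x - c)"
    by (intro continuous_intros continuous_on_subset[OF assms(1)]) auto
  hence "f x - m * x - c = 0"
    by (rule continuous_constant_on_closure[OF _ _ assms(3)]) (simp add: assms(2))
  thus ?thesis by simp
qed

text \<open>Serves to show that a test against a breakpoint or a crossing time has the same answer
  throughout an interval that avoids it.\<close>

lemma same_side:
  fixes r :: real
  assumes "is_interval I" "r \<notin> I" "t \<in> I" "u \<in> I"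
  shows "r \<le> t \<longleftrightarrow> r \<le> u"
  using mem_is_interval_1_I[OF assms(1) assms(3,4), of r]
    mem_is_interval_1_I[OF assms(1) assms(4,3), of r] assms(2) by linarith

text \<open>The sorted elements of \<open>S\<close> serve as breakpoints: an open piece between
  neighbours avoids \<open>S\<close>, so it is affine by assumption, and continuity adds its left
  end. Breakpoints of \<open>pl_with\<close> need not be genuine changes of slope, so
  \<open>S\<close> may contain more points than the kinks of \<open>h\<close>.\<close>

lemma piecewise_linearI:
  assumes "finite S" "continuous_on UNIV h"
    and aff: "\<And>I. is_interval I \<Longrightarrow> I \<inter> S = {} \<Longrightarrow> \<exists>m. has_slope_on h m I"
  shows "piecewise_linear h"
proof -
  define N where "N = card S"
  define xs where "xs = sorted_list_of_set S"
  define g where "g i = xs ! (i - 1)" for i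
  have xs: "length xs = N" "set xs = S" "sorted_wrt (<) xs"
    using assms(1) by (auto simp: xs_def N_def)
  have g_less: "g i < g k" if "1 \<le> i" "i < k" "k \<le> N" for i k
    unfolding g_def using that xs by (intro sorted_wrt_nth_less[OF xs(3)]) auto
  have "\<exists>m. has_slope_on h m {x. ext_bp N g i \<le> ereal x \<and> ereal x < ext_bp N g (i + 1)}"
    if i: "i \<le> N" for i
  proof -
    define I where "I = {x. ext_bp N g i < ereal x \<and> ereal x < ext_bp N g (i + 1)}"
    have "is_interval I"
      unfolding is_interval_1
    proof (intro ballI allI impI)
      fix u v x assume uv: "u \<in> I" "v \<in> I" "u \<le> x \<and> x \<le> v"
      have "ext_bp N g i < ereal x" by (rule less_le_trans[of _ "ereal u"]) (use uv in \<open>auto simp: I_def\<close>)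
      moreover have "ereal x < ext_bp N g (i + 1)"
        by (rule le_less_trans[of _ "ereal v"]) (use uv in \<open>auto simp: I_def\<close>)
      ultimately show "x \<in> I" by (simp add: I_def)
    qed
    moreover have "I \<inter> S = {}"
    proof (rule ccontr)
      assume "I \<inter> S \<noteq> {}"
      then obtain k where k: "k < N" "xs ! k \<in> I" using xs by (metis disjoint_iff in_set_conv_nth)
      hence gk: "g (k + 1) \<in> I" by (simp add: g_def)
      have "\<not> i < k + 1"
      proof
        assume "i < k + 1"
        hence "g (i + 1) \<le> g (k + 1)" "i + 1 \<le> N"
          using g_less[of "i + 1" "k + 1"] k by (cases "i = k"; simp)+
        thus False using gk by (simp add: I_def ext_bp_def)
      qed
      hence "g (k + 1) \<le> g i" "1 \<le> i" using g_less[of "k + 1" i] i by (cases "i = k + 1"; simp)+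
      thus False using gk i by (simp add: I_def ext_bp_def)
    qed
    ultimately obtain m c where mc: "\<And>x. x \<in> I \<Longrightarrow> h x = m * x + c"
      using aff unfolding has_slope_on_def by meson
    \<comment> \<open>The only point of the half-open piece outside \<open>I\<close> is its left
      end, a limit of points of \<open>I\<close> because consecutive breakpoints differ.\<close>
    have "x \<in> closure I" if x: "ext_bp N g i \<le> ereal x" "ereal x < ext_bp N g (i + 1)" for x
    proof (cases "x \<in> I")
      case True
      thus ?thesis using closure_subset by blast
    next
      case False
      hence "ext_bp N g i = ereal x" using x by (auto simp: I_def)
      hence i1: "1 \<le> i" "g i = x" using i by (auto simp: ext_bp_def split: if_splits)
      show ?thesis
      proof (cases "i = N")
        case True
        hence "I = {x<..}" using i1 by (auto simp: I_def ext_bp_def)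
        thus ?thesis by simp
      next
        case ne: False
        hence "I = {x<..<g (i + 1)}" using i1 i by (auto simp: I_def ext_bp_def)
        moreover have "x < g (i + 1)" using g_less[of i "i + 1"] i1 i ne by simp
        ultimately show ?thesis by simp
      qed
    qed
    hence "has_slope_on h m {x. ext_bp N g i \<le> ereal x \<and> ereal x < ext_bp N g (i + 1)}"
      unfolding has_slope_on_def using affine_on_closure[OF assms(2) mc] by blast
    thus ?thesis ..
  qed
  then obtain m where "\<forall>i\<le>N. has_slope_on h (m i) {x. ext_bp N g i \<le> ereal x \<and> ereal x < ext_bp N g (i + 1)}"
    by metis
  moreover have "strict_mono_on {1..N} g" using g_less by (intro strict_mono_onI) auto
  ultimately show ?thesis unfolding piecewise_linear_def pl_with_def by blast
qed

subsection \<open>Interlacing of valleys and ridges\<close>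

text \<open>Turns positions in a sorted list into cardinalities, so that the later index arguments
  become counting. By sortedness, either the first \<open>j\<close> elements all lie in
  \<open>{..p}\<close>, or only elements at earlier positions do.\<close>

lemma nth_sorted_list_of_set_le_iff:
  fixes S :: "nat set"
  assumes "finite S" "1 \<le> j" "j \<le> card S"
  shows "sorted_list_of_set S ! (j - 1) \<le> p \<longleftrightarrow> j \<le> card (S \<inter> {..p})"
proof -
  define xs where "xs = sorted_list_of_set S"
  have len: "length xs = card S" and st: "set xs = S" and d: "distinct xs" and so: "sorted xs"
    unfolding xs_def using assms by auto
  show ?thesis unfolding xs_def[symmetric]
  proof
    assume le: "xs ! (j - 1) \<le> p"
    have "(!) xs ` {..<j} \<subseteq> S \<inter> {..p}"
    proof
      fix x assume "x \<in> (!) xs ` {..<j}"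
      then obtain k where k: "k < j" "x = xs ! k" by auto
      have "xs ! k \<le> xs ! (j - 1)" using so k assms len by (intro sorted_nth_mono) auto
      thus "x \<in> S \<inter> {..p}" using k le st assms len by (auto intro: order_trans)
    qed
    moreover have "card ((!) xs ` {..<j}) = j"
      using d assms len by (subst card_image) (auto simp: inj_on_def nth_eq_iff_index_eq)
    ultimately show "j \<le> card (S \<inter> {..p})" using assms by (metis card_mono finite_Int)
  next
    assume j: "j \<le> card (S \<inter> {..p})"
    show "xs ! (j - 1) \<le> p"
    proof (rule ccontr)
      assume n: "\<not> xs ! (j - 1) \<le> p"
      have "S \<inter> {..p} \<subseteq> (!) xs ` {..<j - 1}"
      proof
        fix x assume x: "x \<in> S \<inter> {..p}"
        then obtain k where k: "k < length xs" "x = xs ! k" using st by (metis IntD1 in_set_conv_nth)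
        have "k < j - 1"
        proof (rule ccontr)
          assume "\<not> k < j - 1"
          hence "xs ! (j - 1) \<le> xs ! k" using so k by (intro sorted_nth_mono) auto
          thus False using n x k by auto
        qed
        thus "x \<in> (!) xs ` {..<j - 1}" using k by auto
      qed
      hence "card (S \<inter> {..p}) \<le> card ((!) xs ` {..<j - 1})" by (intro card_mono) auto
      also have "\<dots> \<le> card {..<j - 1}" by (rule card_image_le) auto
      finally show False using j assms by simp
    qed
  qed
qed

context pl_setting
begin

lemma finite_up_set: "finite up_set" and finite_down_set: "finite down_set"
  by (auto simp: up_set_def down_set_def)

lemma a_in_up_set: "1 \<le> j \<Longrightarrow> j \<le> card up_set \<Longrightarrow> a j \<in> up_set"
  unfolding a_def using finite_up_set
  by (metis diff_less length_sorted_list_of_set less_le_trans nth_mem set_sorted_list_of_set zero_less_one)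

lemma b_in_down_set: "1 \<le> j \<Longrightarrow> j \<le> card down_set \<Longrightarrow> b j \<in> down_set"
  unfolding b_def using finite_down_set
  by (metis diff_less length_sorted_list_of_set less_le_trans nth_mem set_sorted_list_of_set zero_less_one)

text \<open>Counting functions of the valley and ridge indices. Through \<open>a_le_iff\<close> and
  \<open>b_le_iff\<close>, comparisons with \<open>a j\<close> and \<open>b j\<close> become
  comparisons of counts.\<close>

definition num_up :: "nat \<Rightarrow> nat" where
  "num_up p = card (up_set \<inter> {..p})"

definition num_down :: "nat \<Rightarrow> nat" where
  "num_down p = card (down_set \<inter> {..p})"

lemma a_le_iff: "1 \<le> j \<Longrightarrow> j \<le> card up_set \<Longrightarrow> a j \<le> p \<longleftrightarrow> j \<le> num_up p"
  unfolding a_def num_up_def by (rule nth_sorted_list_of_set_le_iff[OF finite_up_set])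

lemma b_le_iff: "1 \<le> j \<Longrightarrow> j \<le> card down_set \<Longrightarrow> b j \<le> p \<longleftrightarrow> j \<le> num_down p"
  unfolding b_def num_down_def by (rule nth_sorted_list_of_set_le_iff[OF finite_down_set])

text \<open>
  The index \<open>a\<^bsub>j+1\<^esub>\<close> ending the falling run that starts at \<open>b\<^sub>j\<close>, with \<open>M + 1\<close> when there
  is none.
\<close>

definition next_up :: "nat \<Rightarrow> nat" where
  "next_up j = (if j + 1 \<le> card up_set then a (j + 1) else M + 1)"

lemma next_up_le: "next_up j \<le> M + 1"
  using a_in_up_set[of "j + 1"] by (auto simp: next_up_def up_set_def)

lemma next_up_pos: "1 \<le> next_up j"
  using a_in_up_set[of "j + 1"] by (auto simp: next_up_def up_set_def)

lemma next_up_less_iff: "p \<le> M \<Longrightarrow> p < next_up j \<longleftrightarrow> num_up p \<le> j"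
proof -
  have "num_up p \<le> card up_set" unfolding num_up_def by (intro card_mono finite_up_set) auto
  thus "p \<le> M \<Longrightarrow> p < next_up j \<longleftrightarrow> num_up p \<le> j"
    using a_le_iff[of "j + 1" p] by (auto simp: next_up_def)
qed

end

locale pl_fun = pl_setting +
  fixes f :: "real \<Rightarrow> real"
  assumes M_pos: "1 \<le> M"
    and cont_f: "continuous_on UNIV f"
    and mono_f: "mono f"
    and pl_f: "pl_with f M \<gamma> \<mu>"
    and f_zero: "\<And>x. x \<le> \<gamma> 1 \<Longrightarrow> f x = 0"
    and x1_less_x2: "x1 < x2"
    and \<nu>_pos: "0 < \<nu>"
begin

lemma \<mu>_0: "\<mu> 0 = 0"
proof -
  obtain c where c: "\<And>x. x < \<gamma> 1 \<Longrightarrow> f x = \<mu> 0 * x + c"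
    using pl_f M_pos by (force simp: pl_with_def has_slope_on_def ext_bp_def)
  have "\<mu> 0 * (\<gamma> 1 - 1) + c = \<mu> 0 * (\<gamma> 1 - 2) + c"
    using c[of "\<gamma> 1 - 1"] c[of "\<gamma> 1 - 2"] f_zero[of "\<gamma> 1 - 1"] f_zero[of "\<gamma> 1 - 2"] by simp
  thus ?thesis by (simp add: algebra_simps)
qed

text \<open>Crossings of the level \<open>\<nu>\<close> by the slope alternate, and the first one is
  upward because \<open>\<mu> 0 = 0 < \<nu>\<close>. So the counts differ by one exactly while the
  slope is at least \<open>\<nu>\<close>. The interlacing facts below rest on this.\<close>

lemma num_up_eq: "p \<le> M \<Longrightarrow> num_up p = num_down p + (if \<nu> \<le> \<mu> p then 1 else 0)"
proof (induction p)
  case 0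
  have "up_set \<inter> {..0} = {}" "down_set \<inter> {..0} = {}" by (auto simp: up_set_def down_set_def)
  thus ?case using \<mu>_0 \<nu>_pos by (simp add: num_up_def num_down_def)
next
  case (Suc p)
  have *: "S \<inter> {..Suc p} = (if Suc p \<in> S then insert (Suc p) (S \<inter> {..p}) else S \<inter> {..p})" for S
    by (auto simp: le_Suc_eq)
  have "num_up (Suc p) = num_up p + (if Suc p \<in> up_set then 1 else 0)"
    and "num_down (Suc p) = num_down p + (if Suc p \<in> down_set then 1 else 0)"
    unfolding num_up_def num_down_def * by auto
  with Suc show ?case by (auto simp: up_set_def down_set_def)
qed

lemma b_bounds:
  assumes "1 \<le> j" "j \<le> card down_set"
  shows "1 \<le> b j" "b j \<le> M" "\<mu> (b j) < \<nu>"
  using b_in_down_set[OF assms] by (auto simp: down_set_def)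

lemma num_down_le: "num_down p \<le> card down_set" and num_up_le: "num_up p \<le> card up_set"
  unfolding num_up_def num_down_def by (auto intro!: card_mono finite_up_set finite_down_set)

lemma num_down_M: "num_down M = card down_set" and num_up_M: "num_up M = card up_set"
  unfolding num_up_def num_down_def
  by (auto intro!: arg_cong[where f = card] simp: up_set_def down_set_def)

lemma num_down_b:
  assumes "1 \<le> j" "j \<le> card down_set"
  shows "num_down (b j) = j"
proof (rule antisym)
  show "j \<le> num_down (b j)" using b_le_iff[OF assms, of "b j"] by simp
  show "num_down (b j) \<le> j"
  proof (rule ccontr)
    assume "\<not> num_down (b j) \<le> j"
    hence j: "j + 1 \<le> num_down (b j)" by simp
    hence "j + 1 \<le> card down_set" using num_down_le order_trans by blast
    hence "b (j + 1) \<le> b j" using b_le_iff[of "j + 1" "b j"] j by simp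
    moreover have "b j < b (j + 1)"
      unfolding b_def using assms finite_down_set \<open>j + 1 \<le> card down_set\<close>
      by (intro strict_sorted_list_of_set[THEN sorted_wrt_nth_less]) auto
    ultimately show False by simp
  qed
qed

lemma card_le: "card down_set \<le> card up_set" "card up_set \<le> card down_set + 1"
  using num_up_eq[of M] by (auto simp: num_down_M num_up_M)

lemma num_up_b:
  assumes "1 \<le> j" "j \<le> card down_set"
  shows "num_up (b j) = j"
  using num_up_eq[of "b j"] b_bounds[OF assms] num_down_b[OF assms] by simp

lemma b_less_next_up:
  assumes "1 \<le> j" "j \<le> card down_set"
  shows "b j < next_up j"
  using next_up_less_iff[of "b j"] b_bounds[OF assms] num_up_b[OF assms] by simp

text \<open>At least \<open>j\<close> ridges and at most \<open>j\<close> valleys have been passed,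
  which by \<open>num_up_eq\<close> leaves no room for a slope of at least \<open>\<nu>\<close>. The
  case \<open>j = 0\<close> is the initial descent, before the first valley.\<close>

lemma falling:
  assumes "j \<le> card down_set" "1 \<le> j \<Longrightarrow> b j \<le> p" "p \<le> M" "p < next_up j"
  shows "\<mu> p < \<nu>"
proof (rule ccontr)
  assume "\<not> \<mu> p < \<nu>"
  hence "num_up p = num_down p + 1" using num_up_eq[OF assms(3)] by simp
  moreover have "num_up p \<le> j" using next_up_less_iff assms by blast
  moreover have "j \<le> num_down p" using b_le_iff[of j p] assms by (cases "j = 0") auto
  ultimately show False by simp
qed

text \<open>The mirror count: at least \<open>j\<close> valleys but fewer than \<open>j\<close>
  ridges have been passed.\<close>

lemma rising:
  assumes "1 \<le> j" "j \<le> card down_set" "a j \<le> p" "p < b j"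
  shows "\<nu> \<le> \<mu> p"
proof (rule ccontr)
  assume "\<not> \<nu> \<le> \<mu> p"
  moreover have "p \<le> M" using assms b_bounds[of j] by simp
  ultimately have "num_up p = num_down p" using num_up_eq[of p] by simp
  moreover have "j \<le> num_up p" using a_le_iff[of j p] assms card_le by simp
  moreover have "num_down p < j" using b_le_iff[of j p] assms by simp
  ultimately show False by simp
qed

lemma a_less_b:
  assumes "1 \<le> j" "j \<le> card down_set"
  shows "a j < b j"
proof -
  have "a j \<le> b j" using a_le_iff[of j "b j"] num_up_b[OF assms] assms card_le by simp
  moreover have "\<nu> \<le> \<mu> (a j)" using a_in_up_set[of j] assms card_le by (auto simp: up_set_def)
  ultimately show ?thesis using b_bounds[OF assms] by (metis le_neq_implies_less not_less)
qed

text \<open>Finds the valley at which the rise through piece \<open>p\<close> starts: the last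
  valley index not above \<open>p\<close>, with no ridge in between.\<close>

lemma rising_at:
  assumes "p \<le> M" "\<nu> \<le> \<mu> p"
  obtains j where "j = num_up p" "1 \<le> j" "j \<le> card up_set" "a j \<le> p"
    "\<And>q. a j \<le> q \<Longrightarrow> q \<le> p \<Longrightarrow> \<nu> \<le> \<mu> q"
proof -
  let ?j = "num_up p"
  have j: "?j = num_down p + 1" using num_up_eq assms by simp
  have 2: "a ?j \<le> p" using a_le_iff[of ?j p] j num_up_le[of p] by simp
  show thesis
  proof
    fix q assume q: "a ?j \<le> q" "q \<le> p"
    have "?j \<le> num_up q" using a_le_iff[of ?j q] q j num_up_le[of p] by simp
    moreover have "num_down q \<le> num_down p"
      unfolding num_down_def using q by (intro card_mono finite_Int) (auto simp: finite_down_set)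
    ultimately show "\<nu> \<le> \<mu> q" using num_up_eq[of q] q assms j by (auto split: if_splits)
  qed (use j 2 num_up_le[of p] in auto)
qed

text \<open>Finds the descent that contains piece \<open>p\<close>: its ridge is the last one
  passed, and index \<open>0\<close> stands for the initial descent.\<close>

lemma falling_at:
  assumes "p \<le> M" "\<mu> p < \<nu>"
  obtains j where "j = num_up p" "j \<le> card down_set" "1 \<le> j \<Longrightarrow> b j \<le> p" "p < next_up j"
proof -
  have "num_up p = num_down p" using num_up_eq assms by simp
  thus thesis
    using that[of "num_up p"] num_down_le[of p] b_le_iff[of "num_up p" p] next_up_less_iff[of p] assms
    by auto
qed

lemma next_up_le_b:
  assumes "j < j'" "j' \<le> card down_set"
  shows "next_up j \<le> b j'"
  using next_up_less_iff[of "b j'" j] b_bounds[of j'] num_up_b[of j'] assms by force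

subsection \<open>Window minima and crossings\<close>

definition F :: "real \<Rightarrow> real" where
  "F y = f y - \<nu> * y"

text \<open>Closed on both sides, unlike the pieces of \<open>pl_with\<close>, so that a breakpoint
  belongs to both of its neighbours and the increment formula \<open>F_diff\<close> applies up to
  it.\<close>

definition piece :: "nat \<Rightarrow> real set" where
  "piece p = {y. \<Gamma> p \<le> ereal y \<and> ereal y \<le> \<Gamma> (p + 1)}"

lemma cont_F: "continuous_on S F"
  unfolding F_def by (intro continuous_intros continuous_on_subset[OF cont_f]) auto

lemma \<gamma>_less: "1 \<le> p \<Longrightarrow> p < q \<Longrightarrow> q \<le> M \<Longrightarrow> \<gamma> p < \<gamma> q"
  using pl_f by (auto simp: pl_with_def strict_mono_on_def)

lemma \<Gamma>_less: "p < q \<Longrightarrow> q \<le> M + 1 \<Longrightarrow> \<Gamma> p < \<Gamma> q"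
  using \<gamma>_less[of p q] by (auto simp: ext_bp_def)

lemma \<Gamma>_mono: "p \<le> q \<Longrightarrow> \<Gamma> p \<le> \<Gamma> q"
  using \<gamma>_less[of p q] by (cases "p = q") (auto simp: ext_bp_def)

lemma \<Gamma>_less_iff: "p \<le> M + 1 \<Longrightarrow> q \<le> M + 1 \<Longrightarrow> \<Gamma> p < \<Gamma> q \<longleftrightarrow> p < q"
  using \<Gamma>_less[of p q] \<Gamma>_mono[of q p] by (meson leD not_le_imp_less)

lemma \<Gamma>_real: "1 \<le> p \<Longrightarrow> p \<le> M \<Longrightarrow> \<Gamma> p = ereal (\<gamma> p)"
  by (simp add: ext_bp_def)

lemma piece_closure:
  assumes "p \<le> M"
  shows "piece p \<subseteq> closure {x. \<Gamma> p \<le> ereal x \<and> ereal x < \<Gamma> (p + 1)}"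
proof -
  consider "p = 0" | "1 \<le> p" "p = M" | "1 \<le> p" "p < M" using assms by linarith
  thus ?thesis
  proof cases
    case 1
    hence "{x. \<Gamma> p \<le> ereal x \<and> ereal x < \<Gamma> (p + 1)} = {..<\<gamma> 1}"
      using M_pos by (auto simp: ext_bp_def)
    thus ?thesis using 1 M_pos by (auto simp: ext_bp_def piece_def)
  next
    case 2
    have "piece p \<subseteq> {x. \<Gamma> p \<le> ereal x \<and> ereal x < \<Gamma> (p + 1)}"
      using 2 by (auto simp: ext_bp_def piece_def)
    thus ?thesis using closure_subset by blast
  next
    case 3
    have eq: "{x. \<Gamma> p \<le> ereal x \<and> ereal x < \<Gamma> (p + 1)} = {\<gamma> p..<\<gamma> (p + 1)}"
      using 3 by (auto simp: ext_bp_def)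
    have "\<gamma> p < \<gamma> (p + 1)" using 3 by (intro \<gamma>_less) auto
    thus ?thesis unfolding eq using 3 by (auto simp: ext_bp_def piece_def)
  qed
qed

lemma F_diff:
  assumes "p \<le> M" "x \<in> piece p" "y \<in> piece p"
  shows "F y - F x = (\<mu> p - \<nu>) * (y - x)"
proof -
  let ?S = "{x. \<Gamma> p \<le> ereal x \<and> ereal x < \<Gamma> (p + 1)}"
  obtain c where c: "\<And>x. x \<in> ?S \<Longrightarrow> f x = \<mu> p * x + c"
    using pl_f assms(1) unfolding pl_with_def has_slope_on_def by meson
  have "f z = \<mu> p * z + c" if "z \<in> piece p" for z
    by (rule affine_on_closure[OF cont_f, of ?S]) (use c that piece_closure[OF assms(1)] in auto)
  thus ?thesis using assms by (simp add: F_def algebra_simps)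
qed

text \<open>The index is the largest \<open>p\<close> with \<open>\<Gamma> p \<le> ereal y\<close>.
  Its half-open convention is that of the initial \<open>h\<close> in
  \<open>\<omega>\<close>.\<close>

lemma left_closed_piece:
  obtains p where "p \<le> M" "\<Gamma> p \<le> ereal y" "ereal y < \<Gamma> (p + 1)"
proof -
  define p where "p = Max {p. p \<le> M \<and> \<Gamma> p \<le> ereal y}"
  have fin: "finite {p. p \<le> M \<and> \<Gamma> p \<le> ereal y}" by auto
  have "0 \<in> {p. p \<le> M \<and> \<Gamma> p \<le> ereal y}" by (simp add: ext_bp_def)
  hence p: "p \<in> {p. p \<le> M \<and> \<Gamma> p \<le> ereal y}" unfolding p_def using fin by (intro Max_in) auto
  have "ereal y < \<Gamma> (p + 1)"
  proof (cases "p = M")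
    case False
    show ?thesis
    proof (rule ccontr)
      assume "\<not> ereal y < \<Gamma> (p + 1)"
      hence "p + 1 \<in> {p. p \<le> M \<and> \<Gamma> p \<le> ereal y}" using p False by auto
      hence "p + 1 \<le> p" unfolding p_def by (rule Max_ge[OF fin])
      thus False by simp
    qed
  qed (simp add: ext_bp_def)
  thus thesis using p that by auto
qed

text \<open>The convention of \<open>k\<close> in \<open>second_output\<close>: when
  \<open>y\<close> is a breakpoint, the index is one less than in
  \<open>left_closed_piece\<close>.\<close>

lemma right_closed_piece:
  obtains p where "p \<le> M" "\<Gamma> p < ereal y" "ereal y \<le> \<Gamma> (p + 1)"
proof -
  obtain p where p: "p \<le> M" "\<Gamma> p \<le> ereal y" "ereal y < \<Gamma> (p + 1)" using left_closed_piece .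
  show thesis
  proof (cases "\<Gamma> p = ereal y")
    case True
    hence "p \<noteq> 0" by (cases "p = 0") (auto simp: ext_bp_def)
    moreover have "\<Gamma> (p - 1) < \<Gamma> p" using p \<open>p \<noteq> 0\<close> by (intro \<Gamma>_less) auto
    ultimately show thesis using that[of "p - 1"] p True by auto
  next
    case False
    thus thesis using p that[of p] by auto
  qed
qed

text \<open>Induction on the last piece, splitting at \<open>\<Gamma> k\<close> when that breakpoint
  separates \<open>x\<close> from \<open>y\<close>. Stated for a transitive \<open>R\<close>, so
  that strict decrease and weak increase share one induction.\<close>

lemma F_chain:
  assumes "transp R"
    and "\<And>p x y. i \<le> p \<Longrightarrow> p < k \<Longrightarrow> x < y \<Longrightarrow> x \<in> piece p \<Longrightarrow> y \<in> piece p \<Longrightarrow> R (F x) (F y)"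
    and "x < y" "\<Gamma> i \<le> ereal x" "ereal y \<le> \<Gamma> k"
  shows "R (F x) (F y)"
  using assms(2,3,5)
proof (induction k arbitrary: y)
  case 0
  thus ?case by (simp add: ext_bp_def)
next
  case (Suc k)
  have "\<Gamma> i < \<Gamma> (Suc k)" using assms(4) Suc.prems by (meson ereal_less_eq(3) less_ereal.simps(1) order_le_less_trans order_less_le_trans)
  hence ik: "i \<le> k" using \<Gamma>_mono[of "Suc k" i] by (metis leD not_less_eq_eq)
  show ?case
  proof (cases "ereal y \<le> \<Gamma> k")
    case True
    show ?thesis by (rule Suc.IH) (use Suc.prems True in auto)
  next
    case False
    show ?thesis
    proof (cases "\<Gamma> k \<le> ereal x")
      case True
      have "\<Gamma> k \<le> ereal y" using False by auto
      moreover have "ereal x \<le> \<Gamma> (Suc k)"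
        using Suc.prems by (meson ereal_less_eq(3) less_imp_le order_trans)
      ultimately show ?thesis
        using Suc.prems(1)[of k x y] Suc.prems ik True by (auto simp: piece_def)
    next
      case 3: False
      then obtain g where g: "\<Gamma> k = ereal g" using False by (cases "\<Gamma> k") auto
      have 1: "R (F x) (F g)" by (rule Suc.IH) (use Suc.prems 3 g in auto)
      have 2: "R (F g) (F y)"
        using Suc.prems(1)[of k g y] Suc.prems(3) False g ik \<Gamma>_mono[of k "Suc k"]
        by (auto simp: piece_def)
      show ?thesis using assms(1) 1 2 by (meson transpD)
    qed
  qed
qed

lemma F_falling:
  assumes "\<And>p. i \<le> p \<Longrightarrow> p < k \<Longrightarrow> \<mu> p < \<nu>" "k \<le> M + 1"
    and "x < y" "\<Gamma> i \<le> ereal x" "ereal y \<le> \<Gamma> k"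
  shows "F y < F x"
proof -
  have "(\<lambda>u v. v < u) (F x) (F y)"
  proof (rule F_chain[OF _ _ assms(3-5)])
    fix p x y assume *: "i \<le> p" "p < k" "x < y" "x \<in> piece p" "y \<in> piece p"
    hence "F y - F x = (\<mu> p - \<nu>) * (y - x)" using F_diff assms(2) by auto
    moreover have "(\<mu> p - \<nu>) * (y - x) < 0" using * assms(1)[of p] by (simp add: mult_neg_pos)
    ultimately show "F y < F x" by simp
  qed (auto simp: transp_def)
  thus ?thesis .
qed

lemma F_rising:
  assumes "\<And>p. i \<le> p \<Longrightarrow> p < k \<Longrightarrow> \<nu> \<le> \<mu> p" "k \<le> M + 1"
    and "x \<le> y" "\<Gamma> i \<le> ereal x" "ereal y \<le> \<Gamma> k"
  shows "F x \<le> F y"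
proof (cases "x = y")
  case False
  show ?thesis
  proof (rule F_chain[where R = "(\<le>)", OF _ _ _ assms(4,5)])
    fix p x y assume *: "i \<le> p" "p < k" "x < y" "x \<in> piece p" "y \<in> piece p"
    hence "F y - F x = (\<mu> p - \<nu>) * (y - x)" using F_diff assms(2) by auto
    moreover have "0 \<le> (\<mu> p - \<nu>) * (y - x)" using * assms(1)[of p] by simp
    ultimately show "F x \<le> F y" by simp
  qed (use False assms in \<open>auto simp: transp_def\<close>)
qed simp

section \<open>Minima over closed intervals\<close>

definition mn :: "real \<Rightarrow> real \<Rightarrow> real" where
  "mn u v = Inf (F ` {u..v})"

lemma mn_le_attained:
  assumes "u \<le> v"
  shows "\<exists>y\<in>{u..v}. F y = mn u v \<and> (\<forall>z\<in>{u..v}. F y \<le> F z)"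
proof -
  obtain y where y: "y \<in> {u..v}" "\<forall>z\<in>{u..v}. F y \<le> F z"
    using continuous_attains_inf[of "{u..v}" F] assms cont_F by auto
  moreover have "mn u v = F y" unfolding mn_def using y by (intro cInf_eq_minimum) auto
  ultimately show ?thesis by auto
qed

lemma mn_attained:
  assumes "u \<le> v"
  obtains y where "u \<le> y" "y \<le> v" "F y = mn u v"
  using mn_le_attained[OF assms] by auto

lemma mn_le: "u \<le> y \<Longrightarrow> y \<le> v \<Longrightarrow> mn u v \<le> F y"
  using mn_le_attained[of u v] by (metis atLeastAtMost_iff order_trans)

lemma mn_eqI:
  assumes "u \<le> y" "y \<le> v" "\<And>z. u \<le> z \<Longrightarrow> z \<le> v \<Longrightarrow> F y \<le> F z"
  shows "mn u v = F y"
  unfolding mn_def using assms by (intro cInf_eq_minimum) auto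

lemma mn_split:
  assumes "u \<le> v" "v \<le> w"
  shows "mn u w = min (mn u v) (mn v w)"
proof -
  obtain y where y: "u \<le> y" "y \<le> w" "F y = mn u w"
    using mn_attained[OF order_trans[OF assms]] .
  obtain y1 where y1: "u \<le> y1" "y1 \<le> v" "F y1 = mn u v" using mn_attained[OF assms(1)] .
  obtain y2 where y2: "v \<le> y2" "y2 \<le> w" "F y2 = mn v w" using mn_attained[OF assms(2)] .
  have "mn u w \<le> F y1" "mn u w \<le> F y2" using y1 y2 assms mn_le[of u y1 w] mn_le[of u y2 w] by auto
  moreover have "mn u v \<le> F y \<or> mn v w \<le> F y"
    using mn_le[of u y v] mn_le[of v y w] y by linarith
  ultimately show ?thesis using y y1 y2 by auto
qed

lemma mn_mono: "u \<le> u' \<Longrightarrow> u' \<le> v \<Longrightarrow> mn u v \<le> mn u' v"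
  using mn_split[of u u' v] by simp

text \<open>\<open>F\<close> is affine on a piece, hence least at an end; the sign of
  \<open>\<mu> p - \<nu>\<close> tells which.\<close>

lemma mn_piece:
  assumes "p \<le> M" "u \<in> piece p" "v \<in> piece p" "u \<le> v"
  shows "mn u v = min (F u) (F v)"
proof (cases "\<nu> \<le> \<mu> p")
  have in_piece: "z \<in> piece p" if "u \<le> z" "z \<le> v" for z
    using assms that unfolding piece_def
    by (auto intro: order_trans[of _ "ereal u"] order_trans[of _ "ereal v"])
  case True
  have "F u \<le> F z" if "u \<le> z" "z \<le> v" for z
    using F_diff[OF assms(1,2) in_piece[OF that]] True that by (smt (verit) mult_nonneg_nonneg)
  thus ?thesis using mn_eqI[of u u v] assms by auto
next
  have in_piece: "z \<in> piece p" if "u \<le> z" "z \<le> v" for z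
    using assms that unfolding piece_def
    by (auto intro: order_trans[of _ "ereal u"] order_trans[of _ "ereal v"])
  case False
  have "F v \<le> F z" if "u \<le> z" "z \<le> v" for z
    using F_diff[OF assms(1) in_piece[OF that] assms(3)] False that by (smt (verit) mult_nonpos_nonneg)
  thus ?thesis using mn_eqI[of u v v] assms by (auto simp: min_absorb2)
qed

section \<open>Gaps at the ridges and their crossings\<close>

definition L :: real where "L = x2 - x1"

lemma L_pos: "0 < L"
  using x1_less_x2 by (simp add: L_def)

text \<open>The right end of the window, stopped at the valley that ends the \<open>j\<close>-th
  descent. There is no stop when \<open>next_up j = M + 1\<close>; for \<open>j = 0\<close> the stop
  is the first valley, if there is one.\<close>

definition rend :: "nat \<Rightarrow> real \<Rightarrow> real" where
  "rend j s = (if next_up j \<le> M then min (s + L) (\<gamma> (next_up j)) else s + L)"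

lemma rend_le: "rend j s \<le> s + L" "ereal (rend j s) \<le> \<Gamma> (next_up j)"
  using next_up_pos[of j] next_up_le[of j] by (auto simp: rend_def ext_bp_def)

lemma rend_mono: "s \<le> s' \<Longrightarrow> rend j s \<le> rend j s'"
  by (auto simp: rend_def)

lemma F_after:
  assumes "j \<le> card down_set" "1 \<le> j \<Longrightarrow> \<gamma> (b j) \<le> x" "x < y" "ereal y \<le> \<Gamma> (next_up j)"
  shows "F y < F x"
proof (rule F_falling[where i = "if j = 0 then 0 else b j" and k = "next_up j"])
  fix p assume "(if j = 0 then 0 else b j) \<le> p" "p < next_up j"
  thus "\<mu> p < \<nu>" using falling[of j p] assms(1) next_up_le[of j] by (auto split: if_splits)
next
  show "\<Gamma> (if j = 0 then 0 else b j) \<le> ereal x"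
    using assms(1,2) b_bounds[of j] by (auto simp: ext_bp_def)
qed (use next_up_le assms in auto)

lemma \<gamma>_b_less:
  assumes "1 \<le> j" "j \<le> card down_set" "next_up j \<le> M"
  shows "\<gamma> (b j) < \<gamma> (next_up j)"
  using b_less_next_up[of j] b_bounds[of j] assms by (intro \<gamma>_less) auto

lemma rend_ge:
  assumes "1 \<le> j" "j \<le> card down_set" "\<gamma> (b j) - L \<le> s"
  shows "\<gamma> (b j) \<le> rend j s"
  using assms \<gamma>_b_less[of j] by (auto simp: rend_def)

definition gap :: "nat \<Rightarrow> real \<Rightarrow> real" where
  "gap j s = F (rend j s) - mn s (\<gamma> (b j))"

text \<open>Moving \<open>s\<close> to the right can only lower the point reached on the descent,
  and it shrinks the interval whose minimum is subtracted.\<close>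

lemma gap_antimono:
  assumes "1 \<le> j" "j \<le> card down_set" "\<gamma> (b j) - L \<le> s" "s \<le> s'" "s' \<le> \<gamma> (b j)"
  shows "gap j s' \<le> gap j s"
proof -
  have "F (rend j s') \<le> F (rend j s)"
    using F_after[of j "rend j s" "rend j s'"] rend_ge[of j s] rend_mono[of s s' j] rend_le[of j s'] assms
    by (cases "rend j s = rend j s'") auto
  thus ?thesis using mn_mono[of s s' "\<gamma> (b j)"] assms by (simp add: gap_def)
qed

text \<open>A sign change rather than a zero, so that no continuity of \<open>gap\<close> has to be
  shown. The range of \<open>\<sigma>\<close> starts where the right end of the window meets the
  ridge and ends where the left end does.\<close>

definition crossing :: "nat \<Rightarrow> real \<Rightarrow> bool" where
  "crossing j \<sigma> \<longleftrightarrow> \<gamma> (b j) - L \<le> \<sigma> \<and> \<sigma> \<le> \<gamma> (b j) \<and> gap j \<sigma> \<le> 0 \<and>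
     (\<forall>s. \<gamma> (b j) - L \<le> s \<and> s < \<sigma> \<longrightarrow> 0 < gap j s)"

text \<open>
  The minimum at the valley \<open>a\<^bsub>j+1\<^esub>\<close> is never the minimum of the window, because a lower point has
  already entered it when the valley overtakes everything to the left of \<open>b\<^sub>j\<close>.
\<close>

definition skipped :: "nat \<Rightarrow> real \<Rightarrow> bool" where
  "skipped j \<sigma> \<longleftrightarrow> next_up j \<le> M \<and>
     (\<exists>y. \<gamma> (next_up j) < y \<and> y \<le> \<sigma> + L \<and> F y < F (\<gamma> (next_up j)))"

text \<open>If \<open>\<sigma>' < \<sigma>\<close>, then at \<open>\<sigma>'\<close> some point
  before ridge \<open>j\<close> is still lower than the next valley, while ridge \<open>j'\<close>
  has been crossed. So the point reached on the later descent is lower than that valley, and it lies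
  in the window at \<open>\<sigma>\<close>: ridge \<open>j\<close> would be skipped.\<close>

lemma crossing_mono:
  assumes "crossing j \<sigma>" "crossing j' \<sigma>'" "\<not> skipped j \<sigma>"
    and j: "1 \<le> j" "j < j'" "j' \<le> card down_set"
  shows "\<sigma> \<le> \<sigma>'"
proof (rule ccontr)
  assume "\<not> \<sigma> \<le> \<sigma>'"
  hence less: "\<sigma>' < \<sigma>" by simp
  have nu: "next_up j \<le> b j'" using next_up_le_b j by simp
  have bj': "1 \<le> b j'" "b j' \<le> M" using b_bounds[of j'] j by auto
  hence nuM: "next_up j \<le> M" using nu by simp
  have g: "\<gamma> (next_up j) \<le> \<gamma> (b j')"
    using nu bj' next_up_pos[of j] \<gamma>_less[of "next_up j" "b j'"] by (cases "next_up j = b j'") auto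
  have g0: "\<gamma> (b j) < \<gamma> (next_up j)" using \<gamma>_b_less j nuM by simp
  have s: "\<gamma> (b j') - L \<le> \<sigma>'" "gap j' \<sigma>' \<le> 0" using assms by (auto simp: crossing_def)
  hence "0 < gap j \<sigma>'" using assms(1) less g g0 by (auto simp: crossing_def)
  have s2: "\<sigma>' \<le> \<gamma> (b j)" using assms(1) less by (auto simp: crossing_def)
  \<comment> \<open>The window at \<open>\<sigma>'\<close> reaches ridge \<open>j'\<close>, hence
    also the valley ending descent \<open>j\<close>, so \<open>gap j\<close> compares with the
    valley itself.\<close>
  have "rend j \<sigma>' = \<gamma> (next_up j)" using nuM s g by (auto simp: rend_def)
  hence "mn \<sigma>' (\<gamma> (b j)) < F (\<gamma> (next_up j))" using \<open>0 < gap j \<sigma>'\<close> by (simp add: gap_def)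
  moreover have "mn \<sigma>' (\<gamma> (b j')) \<le> mn \<sigma>' (\<gamma> (b j))"
    using mn_split[of \<sigma>' "\<gamma> (b j)" "\<gamma> (b j')"] s2 g g0 by simp
  ultimately have lt: "F (rend j' \<sigma>') < F (\<gamma> (next_up j))" using s by (simp add: gap_def)
  have "\<gamma> (next_up j) \<le> rend j' \<sigma>'" using rend_ge[of j' \<sigma>'] j s g by simp
  hence "\<gamma> (next_up j) < rend j' \<sigma>'" using lt by (cases "\<gamma> (next_up j) = rend j' \<sigma>'") auto
  moreover have "rend j' \<sigma>' \<le> \<sigma> + L" using rend_le[of j' \<sigma>'] less by simp
  ultimately show False using assms(3) lt nuM by (auto simp: skipped_def)
qed

text \<open>To the left of the candidate, points before ridge \<open>j\<close> are beaten because
  its gap is no longer positive, and points after the ridge because \<open>F\<close> descends. To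
  the right, a lower point would yield a later ridge that is crossed and not skipped, against the
  choice of \<open>j\<close>.\<close>

lemma window_min:
  assumes cross: "\<And>i. 1 \<le> i \<Longrightarrow> i \<le> card down_set \<Longrightarrow> crossing i (\<sigma> i)"
    and j: "j \<le> card down_set" "1 \<le> j \<Longrightarrow> \<sigma> j \<le> s"
    and later: "\<And>i. j < i \<Longrightarrow> i \<le> card down_set \<Longrightarrow> \<not> skipped i (\<sigma> i) \<Longrightarrow> s < \<sigma> i"
    and z: "s \<le> z" "z \<le> s + L"
  shows "F (max s (rend j s)) \<le> F z"
proof -
  define c where "c = max s (rend j s)"
  have c: "s \<le> c" "c \<le> s + L" using rend_le[of j s] L_pos by (auto simp: c_def)
  have left: "F c \<le> F z" if z: "s \<le> z" "z < c" for z
  proof -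
    have c_eq: "c = rend j s" "z < rend j s" using that by (auto simp: c_def max_def split: if_splits)
    show ?thesis
    proof (cases "1 \<le> j \<and> z \<le> \<gamma> (b j)")
      case True
      hence cr: "crossing j (\<sigma> j)" using cross j by auto
      hence "gap j s \<le> 0"
        using gap_antimono[of j "\<sigma> j" s] j True z by (auto simp: crossing_def)
      thus ?thesis using mn_le[of s z "\<gamma> (b j)"] z True by (simp add: gap_def c_eq)
    next
      case False
      hence "F (rend j s) < F z" using j c_eq rend_le by (intro F_after) auto
      thus ?thesis by (simp add: c_eq)
    qed
  qed
  have right: "F c \<le> F z" if z: "c < z" "z \<le> s + L" for z
  proof (rule ccontr)
    assume neg: "\<not> F c \<le> F z"
    have nuM: "next_up j \<le> M" using z c_def by (auto simp: rend_def max_def split: if_splits)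
    have gc: "\<gamma> (next_up j) \<le> c"
      using z nuM by (auto simp: c_def rend_def max_def min_def split: if_splits)
    define m where "m = mn c (s + L)"
    have mlt: "m < F c" using mn_le[of c z "s + L"] z neg by (simp add: m_def)
    \<comment> \<open>The minimizers to the right of \<open>c\<close> form a compact set, so there
      is a leftmost one, \<open>y\<close>.\<close>
    define Z where "Z = {c..s + L} \<inter> F -` {m}"
    have "closed Z"
      unfolding Z_def by (intro continuous_closed_preimage cont_F) auto
    moreover have "bounded Z"
      by (rule bounded_subset[OF bounded_closed_interval]) (auto simp: Z_def)
    ultimately have "compact Z" by (simp add: compact_eq_bounded_closed)
    moreover have "Z \<noteq> {}"
      using mn_attained[OF c(2)] unfolding Z_def m_def by (metis (lifting) IntI atLeastAtMost_iff emptyE singletonI vimageI)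
    ultimately obtain y where y: "y \<in> Z" "\<And>z. z \<in> Z \<Longrightarrow> y \<le> z"
      using compact_attains_inf by metis
    have m_le: "m \<le> F z" if "c \<le> z" "z \<le> s + L" for z
      using that by (auto simp: m_def intro: mn_le)
    have Fy: "F y = m" and yb: "c < y" "y \<le> s + L"
      using y(1) mlt by (auto simp: Z_def order_le_less)
    have before: "m < F z" if "c \<le> z" "z < y" for z
    proof -
      have "z \<notin> Z" using y(2) that by force
      thus ?thesis using m_le[of z] that yb by (auto simp: Z_def)
    qed
    obtain p where p: "p \<le> M" "\<Gamma> p < ereal y" "ereal y \<le> \<Gamma> (p + 1)"
      using right_closed_piece .
    \<comment> \<open>A nonnegative slope of \<open>F\<close> just before \<open>y\<close> would
      make an earlier point \<open>w\<close> of the same piece at least as low, and \<open>y\<close>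
      would not be leftmost.\<close>
    have slope: "\<mu> p < \<nu>"
    proof (rule ccontr)
      assume up: "\<not> \<mu> p < \<nu>"
      obtain w where w: "c \<le> w" "w < y" "\<Gamma> p \<le> ereal w"
      proof (cases "\<Gamma> p")
        case (real g)
        thus thesis using that[of "max c g"] p yb by auto
      next
        case PInf
        thus thesis using p by simp
      next
        case MInf
        thus thesis using that[of c] yb by simp
      qed
      have "ereal w \<le> \<Gamma> (p + 1)" using w p by (meson ereal_less_eq(3) less_imp_le order_trans)
      hence "F w \<le> F y" using w p up by (intro F_rising[of p "p + 1"]) (auto simp: le_less_Suc_eq less_Suc_eq)
      thus False using before[of w] w Fy by simp
    qed
    obtain j' where j': "j' = num_up p" "j' \<le> card down_set" "1 \<le> j' \<Longrightarrow> b j' \<le> p"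
      "p < next_up j'" using falling_at[OF p(1) slope] by metis
    have "\<Gamma> (next_up j) < \<Gamma> (p + 1)"
    proof -
      have "\<Gamma> (next_up j) \<le> ereal c" using gc nuM next_up_pos[of j] by (simp add: \<Gamma>_real)
      also have "\<dots> < ereal y" using yb by simp
      finally show ?thesis using p by simp
    qed
    hence "next_up j < p + 1" using \<Gamma>_less_iff next_up_le[of j] p by simp
    hence jj': "j < j'" using next_up_less_iff[OF p(1), of j] j' by simp
    hence j'1: "1 \<le> j'" by simp
    have bj': "\<gamma> (b j') < y"
    proof -
      have "\<Gamma> (b j') \<le> \<Gamma> p" by (intro \<Gamma>_mono j'(3) j'1)
      thus ?thesis using p b_bounds[OF j'1 j'(2)] by (metis \<Gamma>_real ereal_less_eq(3) leD not_le_imp_less order_le_less_trans)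
    qed
    have y_next: "ereal y \<le> \<Gamma> (next_up j')"
      using p(3) \<Gamma>_mono[of "p + 1" "next_up j'"] j'(4) by (auto intro: order_trans)
    \<comment> \<open>Otherwise the descent would continue inside the window beyond
      \<open>y\<close>.\<close>
    have y_eq: "y = rend j' s"
    proof (rule ccontr)
      assume ne: "y \<noteq> rend j' s"
      have "y \<le> rend j' s" using y_next yb next_up_pos[of j'] by (auto simp: rend_def ext_bp_def)
      hence "F (rend j' s) < F y"
        using F_after[of j' y "rend j' s"] ne j'(2) bj' rend_le[of j' s] by simp
      moreover have "m \<le> F (rend j' s)"
        using m_le \<open>y \<le> rend j' s\<close> rend_le[of j' s] yb by simp
      ultimately show False using Fy by simp
    qed
    have cr: "crossing j' (\<sigma> j')" using cross j'1 j'(2) by simp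
    \<comment> \<open>Either ridge \<open>j'\<close> has left the window, so its crossing is past,
      or nothing in the window before that ridge is lower than \<open>y\<close>, so its gap is not
      positive.\<close>
    have \<sigma>_le: "\<sigma> j' \<le> s"
    proof (cases "\<gamma> (b j') < s")
      case True
      thus ?thesis using cr by (auto simp: crossing_def)
    next
      case False
      hence "s \<le> \<gamma> (b j')" by simp
      then obtain v where v: "s \<le> v" "v \<le> \<gamma> (b j')" "F v = mn s (\<gamma> (b j'))"
        by (rule mn_attained)
      have "m \<le> F v"
        using left[of v] m_le[of v] mlt v bj' yb by (cases "v < c") auto
      hence "gap j' s \<le> 0" using y_eq Fy v by (simp add: gap_def)
      hence "\<not> 0 < gap j' s" by simp
      thus ?thesis using cr bj' yb unfolding crossing_def by (metis add.commute diff_le_eq le_less_trans less_imp_le linorder_not_le)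
    qed
    \<comment> \<open>Skipping would put the valley at \<open>y\<close> and a still lower point into
      the window, against the minimality of \<open>y\<close>.\<close>
    have "\<not> skipped j' (\<sigma> j')"
    proof
      assume "skipped j' (\<sigma> j')"
      then obtain v where v: "next_up j' \<le> M" "\<gamma> (next_up j') < v" "v \<le> \<sigma> j' + L"
        "F v < F (\<gamma> (next_up j'))" by (auto simp: skipped_def)
      hence "y = \<gamma> (next_up j')" using y_eq \<sigma>_le by (simp add: rend_def)
      moreover have "m \<le> F v" using m_le v \<sigma>_le yb calculation by simp
      ultimately show False using v Fy by simp
    qed
    thus False using later[OF jj' j'(2)] \<sigma>_le by simp
  qed
  show ?thesis using left[of z] right[of z] z unfolding c_def[symmetric] by (cases z c rule: linorder_cases) auto
qed

subsection \<open>Correctness of the algorithm\<close>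

lemma \<mu>t_diff:
  assumes "p \<le> M" "x \<in> piece p" "y \<in> piece p"
  shows "\<mu>t p * (ereal y - ereal x) = ereal (F y - F x)"
  using F_diff[OF assms] by (simp add: \<mu>t_def)

lemma \<gamma>_piece: "1 \<le> p \<Longrightarrow> p \<le> M \<Longrightarrow> \<gamma> p \<in> piece p"
  using \<Gamma>_mono[of p "p + 1"] by (simp add: piece_def \<Gamma>_real)

lemma \<gamma>_Suc_piece: "p + 1 \<le> M \<Longrightarrow> \<gamma> (p + 1) \<in> piece p"
  using \<Gamma>_mono[of p "p + 1"] by (simp add: piece_def \<Gamma>_real)

lemma ereal_le_zero_iff: "ereal x \<le> 0 \<longleftrightarrow> x \<le> 0"
  by simp

lemma max_zero_ereal: "max 0 (ereal x) = ereal (max 0 x)"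
  by (simp add: max_def zero_ereal_def)

lemma mn_extend:
  assumes "1 \<le> p" "p + 1 \<le> M" "s \<le> \<gamma> p"
  shows "mn s (\<gamma> (p + 1)) = min (mn s (\<gamma> p)) (F (\<gamma> (p + 1)))"
proof -
  have "\<gamma> p \<le> \<gamma> (p + 1)" using \<gamma>_less[of p "p + 1"] assms by simp
  hence "mn s (\<gamma> (p + 1)) = min (mn s (\<gamma> p)) (min (F (\<gamma> p)) (F (\<gamma> (p + 1))))"
    using mn_split[of s "\<gamma> p" "\<gamma> (p + 1)"] assms
      mn_piece[of p "\<gamma> p" "\<gamma> (p + 1)"] \<gamma>_piece[of p] \<gamma>_Suc_piece[of p] by simp
  moreover have "mn s (\<gamma> p) \<le> F (\<gamma> p)" using mn_le assms by simp
  ultimately show ?thesis by simp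
qed

lemma mn_self: "mn x x = F x"
  by (rule mn_eqI) auto

text \<open>The recursion \<open>max 0 (d + increment)\<close> maintains the height of the current
  breakpoint above the minimum of \<open>F\<close> seen so far: a new minimum resets it to
  \<open>0\<close>.\<close>

lemma left_part_fold:
  assumes "h + 1 \<le> n" "n \<le> M" "s \<in> piece h"
  shows "fold (\<lambda>p d. max 0 (d + \<mu>t p * (\<Gamma> (p + 1) - \<Gamma> p))) [h + 1..<n]
    (max 0 (\<mu>t h * (\<Gamma> (h + 1) - ereal s))) = ereal (F (\<gamma> n) - mn s (\<gamma> n))"
  using assms(1,2)
proof (induction n rule: dec_induct)
  case base
  have "s \<le> \<gamma> (h + 1)" using assms base by (simp add: piece_def \<Gamma>_real)
  hence "mn s (\<gamma> (h + 1)) = min (F s) (F (\<gamma> (h + 1)))"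
    using base assms \<gamma>_Suc_piece[of h] by (intro mn_piece) auto
  thus ?case
    using base assms \<mu>t_diff[of h s "\<gamma> (h + 1)"] \<gamma>_Suc_piece[of h]
    by (simp add: \<Gamma>_real max_zero_ereal max_def min_def)
next
  case (step n)
  have n: "1 \<le> n" "n + 1 \<le> M" using step by auto
  have "\<Gamma> (h + 1) \<le> \<Gamma> n" using step by (intro \<Gamma>_mono) auto
  hence "ereal s \<le> \<Gamma> n" using assms by (auto simp: piece_def intro: order_trans)
  hence "s \<le> \<gamma> n" using n by (simp add: \<Gamma>_real)
  hence m: "mn s (\<gamma> (n + 1)) = min (mn s (\<gamma> n)) (F (\<gamma> (n + 1)))" by (rule mn_extend[OF n])
  have "\<mu>t n * (\<Gamma> (n + 1) - \<Gamma> n) = ereal (F (\<gamma> (n + 1)) - F (\<gamma> n))"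
    using n \<mu>t_diff[of n "\<gamma> n" "\<gamma> (n + 1)"] \<gamma>_piece[of n] \<gamma>_Suc_piece[of n] by (simp add: \<Gamma>_real)
  with step m n show ?case by (simp add: max_zero_ereal max_def min_def)
qed

text \<open>The second alternative occurs when the left end arrives at the ridge. There the fold is
  empty and the starting term has a negative slope factor, so the value is \<open>0\<close>, as it
  should be.\<close>

lemma left_part_eq:
  assumes j: "1 \<le> j" "j \<le> card down_set"
    and h: "h < b j \<and> s \<in> piece h \<or> h = b j \<and> s = \<gamma> (b j)"
  shows "left_part j h (ereal s) = ereal (F (\<gamma> (b j)) - mn s (\<gamma> (b j)))"
  using h
proof
  assume "h < b j \<and> s \<in> piece h"
  thus ?thesis unfolding left_part_def using b_bounds[OF j] by (intro left_part_fold) auto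
next
  assume h: "h = b j \<and> s = \<gamma> (b j)"
  have "\<Gamma> (b j) \<le> \<Gamma> (b j + 1)" by (rule \<Gamma>_mono) simp
  hence "0 \<le> \<Gamma> (b j + 1) - ereal (\<gamma> (b j))"
    using b_bounds[OF j] by (simp add: \<Gamma>_real ereal_diff_positive)
  hence "\<mu>t (b j) * (\<Gamma> (b j + 1) - ereal (\<gamma> (b j))) \<le> 0"
    using b_bounds(3)[OF j]
    by (cases "\<Gamma> (b j + 1)") (auto simp: \<mu>t_def mult_nonpos_nonneg)
  thus ?thesis using h by (simp add: left_part_def mn_self max_absorb1)
qed

lemma seg_sum_eq:
  assumes "1 \<le> lo" "lo \<le> hi" "hi \<le> M"
  shows "seg_sum lo hi = ereal (F (\<gamma> hi) - F (\<gamma> lo))"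
  using assms(2,3)
proof (induction hi rule: dec_induct)
  case base
  show ?case by (simp add: seg_sum_def)
next
  case (step n)
  hence "\<mu>t n * (\<Gamma> (n + 1) - \<Gamma> n) = ereal (F (\<gamma> (n + 1)) - F (\<gamma> n))"
    using assms \<mu>t_diff[of n "\<gamma> n" "\<gamma> (n + 1)"] \<gamma>_piece[of n] \<gamma>_Suc_piece[of n] by (simp add: \<Gamma>_real)
  with step show ?case by (simp add: seg_sum_def)
qed

lemma alg_a_Suc:
  assumes "1 \<le> j" "j \<le> card down_set"
  shows "alg_a j (j + 1) = next_up j"
  using assms card_le by (auto simp: alg_a_def next_up_def)

text \<open>The sums telescope. The branch for \<open>\<xi> = next_up j\<close> drops the last
  partial term, which is correct because \<open>\<theta>\<close> is then the breakpoint
  itself.\<close>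

lemma right_part_eq:
  assumes j: "1 \<le> j" "j \<le> card down_set"
    and \<xi>: "b j \<le> \<xi>" "\<xi> \<le> M" "\<theta> \<in> piece \<xi>" "\<xi> = next_up j \<Longrightarrow> \<theta> = \<gamma> \<xi>"
  shows "right_part j \<xi> (ereal \<theta>) = ereal (F \<theta> - F (\<gamma> (b j)))"
proof -
  have "\<mu>t \<xi> * (ereal \<theta> - \<Gamma> \<xi>) = ereal (F \<theta> - F (\<gamma> \<xi>))"
    using \<xi> b_bounds[OF j] \<mu>t_diff[of \<xi> "\<gamma> \<xi>" \<theta>] \<gamma>_piece[of \<xi>] by (simp add: \<Gamma>_real)
  moreover have "seg_sum (b j) \<xi> = ereal (F (\<gamma> \<xi>) - F (\<gamma> (b j)))"
    using \<xi> b_bounds[OF j] by (intro seg_sum_eq) auto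
  ultimately show ?thesis using \<xi> alg_a_Suc[OF j] by (auto simp: right_part_def)
qed

lemma num_up_mono: "p \<le> q \<Longrightarrow> num_up p \<le> num_up q"
  unfolding num_up_def by (intro card_mono) (auto simp: finite_up_set)

text \<open>Identifies \<open>r\<close> in \<open>first_output\<close> as the number of the first
  valley index above \<open>h\<close>; the conventions of \<open>alg_a\<close> at \<open>0\<close>
  and \<open>j + 1\<close> make it exist.\<close>

lemma alg_a_interval:
  assumes j: "1 \<le> j" "j \<le> card down_set" and h: "h < b j"
  shows "(THE r. r \<in> {1..j + 1} \<and> alg_a j (r - 1) \<le> h \<and> h < alg_a j r) = num_up h + 1"
proof (rule the_equality)
  have hM: "h \<le> M" using h b_bounds[OF j] by simp
  have up: "num_up h \<le> j" using num_up_mono[of h "b j"] num_up_b[OF j] h by simp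
  have lo: "alg_a j (r - 1) \<le> h \<longleftrightarrow> r - 1 \<le> num_up h" if "r \<in> {1..j + 1}" for r
    using that a_le_iff[of "r - 1" h] j card_le by (auto simp: alg_a_def)
  have hi: "h < alg_a j r \<longleftrightarrow> num_up h < r" if r: "r \<in> {1..j + 1}" for r
  proof (cases "r = j + 1")
    case True
    thus ?thesis using alg_a_Suc[OF j] next_up_less_iff[OF hM, of j] by auto
  next
    case False
    thus ?thesis using r a_le_iff[of r h] j card_le by (auto simp: alg_a_def)
  qed
  show "num_up h + 1 \<in> {1..j + 1} \<and> alg_a j (num_up h + 1 - 1) \<le> h \<and> h < alg_a j (num_up h + 1)"
    using lo[of "num_up h + 1"] hi[of "num_up h + 1"] up by simp
  show "r = num_up h + 1" if "r \<in> {1..j + 1} \<and> alg_a j (r - 1) \<le> h \<and> h < alg_a j r" for r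
    using lo[of r] hi[of r] that by auto
qed

text \<open>From \<open>z\<close>, go downhill: on a rising piece to the left, to the valley where
  the rise starts or to \<open>s\<close> if that comes first; on a falling piece to the right, to
  the next valley. So the minimum up to the ridge is among \<open>F s\<close> and the valleys that
  \<open>first_output\<close> inspects.\<close>

lemma lowest_valley:
  assumes j: "1 \<le> j" "j \<le> card down_set"
    and h: "\<Gamma> h \<le> ereal s" and z: "s \<le> z" "z \<le> \<gamma> (b j)"
  shows "F s \<le> F z \<or> (\<exists>q. num_up h < q \<and> q \<le> j \<and> F (\<gamma> (a q)) \<le> F z)"
proof (cases "s = z")
  case False
  obtain p where p: "p \<le> M" "\<Gamma> p < ereal z" "ereal z \<le> \<Gamma> (p + 1)"
    using right_closed_piece .
  have bj: "\<Gamma> (b j) = ereal (\<gamma> (b j))" "b j \<le> M" using b_bounds[OF j] by (auto simp: \<Gamma>_real)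
  have "\<Gamma> p < \<Gamma> (b j)" using p z bj by (metis ereal_less_eq(3) order_less_le_trans)
  hence pb: "p < b j" using \<Gamma>_less_iff[of p "b j"] p bj by simp
  have "\<Gamma> h < \<Gamma> (p + 1)"
    using h z False p(3) by (meson ereal_less_eq(3) less_ereal.simps(1) order_le_imp_less_or_eq order_le_less_trans order_less_le_trans)
  hence hp: "h \<le> p" using \<Gamma>_mono[of "p + 1" h] by (metis leD not_less_eq_eq Suc_eq_plus1)
  show ?thesis
  proof (cases "\<nu> \<le> \<mu> p")
    case True
    obtain q where q: "q = num_up p" "1 \<le> q" "q \<le> card up_set" "a q \<le> p"
      and rise: "\<And>i. a q \<le> i \<Longrightarrow> i \<le> p \<Longrightarrow> \<nu> \<le> \<mu> i"
      using rising_at[OF p(1) True] by metis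
    have a1: "1 \<le> a q" "a q \<le> M" using a_in_up_set[OF q(2,3)] by (auto simp: up_set_def)
    have qj: "q \<le> j" using q num_up_mono[of p "b j"] pb num_up_b[OF j] by simp
    show ?thesis
    proof (cases "a q \<le> h")
      case True
      have "F s \<le> F z"
        by (rule F_rising[of h "p + 1"]) (use True rise h z p in auto)
      thus ?thesis ..
    next
      case False
      have "ereal (\<gamma> (a q)) \<le> ereal z" 
        using order.trans[OF \<Gamma>_mono[OF q(4)] less_imp_le[OF p(2)]] a1 by (simp add: \<Gamma>_real)
      hence "F (\<gamma> (a q)) \<le> F z"
        by (intro F_rising[of "a q" "p + 1"]) (use rise p a1 in \<open>auto simp: \<Gamma>_real\<close>)
      moreover have "num_up h < q" using False a_le_iff[OF q(2,3), of h] by simp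
      ultimately show ?thesis using qj by blast
    qed
  next
    case False
    hence f: "\<mu> p < \<nu>" by simp
    obtain q where q: "q = num_up p" "q \<le> card down_set" "p < next_up q"
      using falling_at[OF p(1) f] by metis
    have "num_up p = num_down p" using num_up_eq[OF p(1)] False by simp
    hence qj: "q < j" using b_le_iff[OF j, of p] pb q by simp
    hence q1: "q + 1 \<le> card up_set" using j card_le by simp
    hence nu: "next_up q = a (q + 1)" by (simp add: next_up_def)
    have a1: "1 \<le> a (q + 1)" "a (q + 1) \<le> M" using a_in_up_set[of "q + 1"] q1 by (auto simp: up_set_def)
    have le: "ereal z \<le> ereal (\<gamma> (a (q + 1)))"
      using \<Gamma>_mono[of "p + 1" "a (q + 1)"] q(3) nu p(3) a1 by (simp add: \<Gamma>_real)
    have "F (\<gamma> (a (q + 1))) \<le> F z"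
    proof (cases "z = \<gamma> (a (q + 1))")
      case ne: False
      have "F (\<gamma> (a (q + 1))) < F z"
      proof (rule F_falling[of p "a (q + 1)"])
        fix i assume i: "p \<le> i" "i < a (q + 1)"
        have "1 \<le> q \<Longrightarrow> b q \<le> p" using falling_at[OF p(1) f] q(1) by metis
        hence "1 \<le> q \<Longrightarrow> b q \<le> i" using i(1) by (meson order_trans)
        thus "\<mu> i < \<nu>" using falling[of q i] i q nu a1 by simp
      qed (use p le ne a1 in \<open>auto simp: \<Gamma>_real\<close>)
      thus ?thesis by simp
    qed simp
    moreover have "num_up h < q + 1" using num_up_mono[OF hp] q by simp
    ultimately show ?thesis using qj by (metis Suc_eq_plus1 Suc_leI)
  qed
qed simp

section \<open>Outputs of the two loops\<close>

definition correct_output :: "nat \<Rightarrow> ereal \<Rightarrow> bool" where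
  "correct_output j w \<longleftrightarrow> (\<exists>\<sigma>. crossing j \<sigma> \<and> w = (if skipped j \<sigma> then \<infinity> else ereal (\<sigma> - x1)))"

text \<open>Positions before \<open>s\<close> need no separate inspection: a positive gap at
  \<open>s\<close> stays positive to the left by \<open>gap_antimono\<close>, and at the start there
  are none.\<close>

lemma crossing_in_segment:
  assumes j: "1 \<le> j" "j \<le> card down_set"
    and s: "\<gamma> (b j) - L \<le> s" "0 \<le> x" "s + x \<le> \<gamma> (b j)"
    and gap: "gap j (s + x) \<le> 0" "\<And>x'. 0 \<le> x' \<Longrightarrow> x' < x \<Longrightarrow> 0 < gap j (s + x')"
    and start: "0 < gap j s \<or> s = \<gamma> (b j) - L"
  shows "crossing j (s + x)"
  unfolding crossing_def
proof (intro conjI allI impI)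
  fix u assume u: "\<gamma> (b j) - L \<le> u \<and> u < s + x"
  show "0 < gap j u"
  proof (cases "s \<le> u")
    case True
    thus ?thesis using gap(2)[of "u - s"] u by simp
  next
    case False
    hence "gap j s \<le> gap j u" using gap_antimono[OF j, of u s] s u by simp
    thus ?thesis using start False u by auto
  qed
qed (use assms in auto)

lemma gap_start_nonneg:
  assumes j: "1 \<le> j" "j \<le> card down_set"
  shows "0 \<le> gap j (\<gamma> (b j) - L)"
proof -
  have "rend j (\<gamma> (b j) - L) = \<gamma> (b j)" using \<gamma>_b_less[OF j] by (simp add: rend_def)
  thus ?thesis using mn_le[of "\<gamma> (b j) - L" "\<gamma> (b j)" "\<gamma> (b j)"] L_pos by (simp add: gap_def)
qed

text \<open>With a constant rate \<open>c\<close> of decrease the sign changes at distance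
  \<open>gap j s / c\<close>, which the sign at the far end keeps within the segment.\<close>

lemma linear_crossing:
  assumes j: "1 \<le> j" "j \<le> card down_set"
    and s: "\<gamma> (b j) - L \<le> s" "0 < p" "s + p \<le> \<gamma> (b j)"
    and lin: "\<And>x. 0 \<le> x \<Longrightarrow> x \<le> p \<Longrightarrow> gap j (s + x) = gap j s - c * x" and "0 < c"
    and "gap j (s + p) \<le> 0"
    and start: "0 < gap j s \<or> s = \<gamma> (b j) - L"
  shows "crossing j (s + gap j s / c)" "gap j s / c \<le> p"
proof -
  have "0 \<le> gap j s" using start gap_start_nonneg[OF j] by auto
  hence 0: "0 \<le> gap j s / c" using assms by simp
  show le: "gap j s / c \<le> p" using lin[of p] assms by (simp add: field_simps)
  show "crossing j (s + gap j s / c)"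
  proof (rule crossing_in_segment[OF j s(1) 0 _ _ _ start])
    show "0 < gap j (s + x')" if "0 \<le> x'" "x' < gap j s / c" for x'
      using lin[of x'] that le \<open>0 < c\<close> by (simp add: field_simps)
    show "gap j (s + gap j s / c) \<le> 0"
      using lin[OF 0 le] \<open>0 < c\<close> by simp
  qed (use le s in auto)
qed

lemma rend_inner: "ereal (s + L) \<le> \<Gamma> (next_up j) \<Longrightarrow> rend j s = s + L"
  using next_up_pos[of j] by (auto simp: rend_def ext_bp_def split: if_splits)

text \<open>Skipping requires a window point strictly beyond the next valley, which this bound on
  the right end excludes.\<close>

lemma correct_outputI:
  assumes "crossing j \<sigma>" "ereal (\<sigma> + L) \<le> \<Gamma> (next_up j)" "w = ereal (\<sigma> - x1)"
  shows "correct_output j w"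
proof -
  have "\<not> skipped j \<sigma>" using assms(2) next_up_pos[of j] by (auto simp: skipped_def \<Gamma>_real)
  thus ?thesis using assms by (auto simp: correct_output_def)
qed

text \<open>While the left end runs through piece \<open>h\<close> and the right end through piece
  \<open>i\<close>, \<open>F\<close> falls linearly at the right end, and the minimum up to the
  ridge is \<open>F\<close> at the left end or at the lowest valley in between. Each output formula
  is the zero of the gap in one of the resulting cases.\<close>

lemma first_output_correct:
  assumes j: "1 \<le> j" "j \<le> card down_set"
    and h: "h < b j" "\<Gamma> h \<le> ereal s"
    and i: "b j \<le> i" "i < next_up j" "\<Gamma> i \<le> ereal (s + L)"
    and p: "0 < p" "s + p \<le> \<gamma> (h + 1)" "ereal (s + p + L) \<le> \<Gamma> (i + 1)"
    and s: "\<gamma> (b j) - L \<le> s"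
    and gap: "gap j (s + p) \<le> 0"
    and start: "0 < gap j s \<or> s = \<gamma> (b j) - L"
  shows "correct_output j (first_output j h i (ereal s) (ereal (gap j s)))"
proof -
  have bj: "1 \<le> b j" "b j \<le> M" using b_bounds[OF j] by auto
  have iM: "i \<le> M" using i next_up_le[of j] by simp
  have hM: "h + 1 \<le> M" using h bj by simp
  have slope_i: "\<mu> i < \<nu>" using falling[of j i] i j iM by simp
  \<comment> \<open>The rate at which \<open>F\<close> falls at the right end;
    \<open>\<mu>t i\<close> is its negative, hence the minus signs in the outputs.\<close>
  define c where "c = \<nu> - \<mu> i"
  have c: "0 < c" using slope_i by (simp add: c_def)
  have \<mu>t_i: "\<mu>t i = ereal (- c)" by (simp add: \<mu>t_def c_def)
  have hb: "\<gamma> (h + 1) \<le> \<gamma> (b j)"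
    using \<gamma>_less[of "h + 1" "b j"] h bj by (cases "h + 1 = b j") auto
  have piece_h: "s + x \<in> piece h" if "0 \<le> x" "x \<le> p" for x
  proof -
    have "\<Gamma> h \<le> ereal (s + x)" by (rule order_trans[OF h(2)]) (use that in simp)
    thus ?thesis using that p hM by (simp add: piece_def \<Gamma>_real)
  qed
  have piece_i: "s + x + L \<in> piece i" if "0 \<le> x" "x \<le> p" for x
  proof -
    have "\<Gamma> i \<le> ereal (s + x + L)" by (rule order_trans[OF i(3)]) (use that in simp)
    moreover have "ereal (s + x + L) \<le> \<Gamma> (i + 1)" by (rule order_trans[OF _ p(3)]) (use that in simp)
    ultimately show ?thesis by (simp add: piece_def)
  qed
  have inner: "ereal (s + x + L) \<le> \<Gamma> (next_up j)" if "0 \<le> x" "x \<le> p" for x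
    using piece_i[OF that] \<Gamma>_mono[of "i + 1" "next_up j"] i by (auto simp: piece_def intro: order_trans)
  have gap_eq: "gap j (s + x) = F (s + L) - c * x - mn (s + x) (\<gamma> (b j))" if "0 \<le> x" "x \<le> p" for x
    using F_diff[OF iM piece_i[of 0] piece_i[OF that]] p that rend_inner[OF inner[OF that]]
    by (simp add: gap_def c_def algebra_simps)
  have out: "correct_output j w" if "crossing j (s + x)" "0 \<le> x" "x \<le> p" "w = ereal (s - x1 + x)" for w x
    using inner[of x] that by (intro correct_outputI[of j "s + x"]) (auto simp: algebra_simps)
  have d0: "0 \<le> gap j s" using start gap_start_nonneg[OF j] by auto
  have F_h: "F (s + x) = F s + (\<mu> h - \<nu>) * x" if "0 \<le> x" "x \<le> p" for x
    using F_diff[OF _ piece_h[of 0] piece_h[OF that]] p hM by simp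
  have sp: "s + p \<le> \<gamma> (b j)" using p hb by simp
  have s_le: "s + x \<le> \<gamma> (b j)" if "x \<le> p" for x using that sp by simp
  show ?thesis
  proof (cases "num_up h < j")
    \<comment> \<open>Here \<open>r = j + 1\<close>: the left end is already on the rise to ridge
      \<open>j\<close>, so it carries the minimum and the gap falls at rate
      \<open>\<mu> h - \<mu> i\<close>.\<close>
    case False
    moreover have "num_up h \<le> j" using num_up_mono[of h "b j"] num_up_b[OF j] h by simp
    ultimately have nu: "num_up h = j" by simp
    hence aj: "a j \<le> h" using a_le_iff[of j h] j card_le by simp
    have slope_h: "\<nu> \<le> \<mu> h" using rising[OF j aj h(1)] .
    have mn_eq: "mn (s + x) (\<gamma> (b j)) = F (s + x)" if x: "0 \<le> x" "x \<le> p" for x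
    proof (rule mn_eqI)
      fix z assume z: "s + x \<le> z" "z \<le> \<gamma> (b j)"
      show "F (s + x) \<le> F z"
        by (rule F_rising[of h "b j"])
          (use z x piece_h[OF x] rising[OF j] aj bj in \<open>auto simp: piece_def \<Gamma>_real\<close>)
    qed (use s_le x in auto)
    have lin: "gap j (s + x) = gap j s - (\<mu> h - \<mu> i) * x" if "0 \<le> x" "x \<le> p" for x
      using gap_eq[OF that] gap_eq[of 0] mn_eq[OF that] mn_eq[of 0] F_h[OF that] p
      by (simp add: c_def algebra_simps)
    have pos: "0 < \<mu> h - \<mu> i" using slope_h slope_i by simp
    note cr = linear_crossing[OF j s p(1) sp lin pos gap start]
    have "first_output j h i (ereal s) (ereal (gap j s)) =
        ereal s - ereal x1 + ereal (gap j s) / (\<mu>t h - \<mu>t i)"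
      unfolding first_output_def alg_a_interval[OF j h(1)] by (simp add: nu)
    also have "\<dots> = ereal (s - x1 + gap j s / (\<mu> h - \<mu> i))" using pos by (simp add: \<mu>t_def)
    finally show ?thesis using cr d0 pos by (intro out[OF cr(1)]) auto
  next
    case True
    define r where "r = num_up h + 1"
    have rj: "r \<le> j" using True by (simp add: r_def)
    define chi where "chi = (\<lambda>q. \<mu>t h * (\<Gamma> (h + 1) - ereal s) + seg_sum (h + 1) (a q))"
    \<comment> \<open>The height of the lowest valley between the left end and ridge
      \<open>j\<close>, measured from \<open>F s\<close>; it is the real form of the minimum of
      \<open>chi\<close>.\<close>
    define m where "m = Min ((\<lambda>q. F (\<gamma> (a q)) - F s) ` {r..j})"
    have aq: "h < a q" "a q \<le> M" "a q < b j" if q: "q \<in> {r..j}" for q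
    proof -
      have q1: "1 \<le> q" "q \<le> card up_set" "q \<le> card down_set" "num_up h < q" "q \<le> j"
        using q j card_le by (auto simp: r_def)
      show "h < a q" using a_le_iff[OF q1(1,2), of h] q1 by simp
      show "a q \<le> M" using a_in_up_set[OF q1(1,2)] by (simp add: up_set_def)
      have "b q \<le> b j" using b_le_iff[OF q1(1,3), of "b j"] num_down_b[OF j] q1 by simp
      thus "a q < b j" using a_less_b[OF q1(1,3)] by simp
    qed
    have chi_eq: "chi q = ereal (F (\<gamma> (a q)) - F s)" if "q \<in> {r..j}" for q
      using aq[OF that] seg_sum_eq[of "h + 1" "a q"] \<mu>t_diff[of h s "\<gamma> (h + 1)"] piece_h[of 0]
        \<gamma>_Suc_piece[OF hM] hM p by (simp add: chi_def \<Gamma>_real)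
    have m_in: "m \<in> (\<lambda>q. F (\<gamma> (a q)) - F s) ` {r..j}"
      unfolding m_def using rj by (intro Min_in) auto
    have m_le: "m \<le> F (\<gamma> (a q)) - F s" if "q \<in> {r..j}" for q
      unfolding m_def using that by (intro Min_le) auto
    have Min_chi: "Min (chi ` {r..j}) = ereal m"
      by (rule Min_eqI) (use m_in m_le chi_eq in \<open>auto intro!: image_eqI\<close>)
    have mn_eq: "mn (s + x) (\<gamma> (b j)) = min (F (s + x)) (F s + m)" if x: "0 \<le> x" "x \<le> p" for x
    proof (rule antisym)
      obtain q where q: "q \<in> {r..j}" "m = F (\<gamma> (a q)) - F s" using m_in by auto
      have "\<gamma> (h + 1) \<le> \<gamma> (a q)" "\<gamma> (a q) \<le> \<gamma> (b j)"
        using \<gamma>_less[of "h + 1" "a q"] \<gamma>_less[of "a q" "b j"] aq[OF q(1)] bj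
        by (cases "h + 1 = a q"; force)+
      hence "mn (s + x) (\<gamma> (b j)) \<le> F (\<gamma> (a q))" using x p by (intro mn_le) auto
      moreover have "mn (s + x) (\<gamma> (b j)) \<le> F (s + x)" using s_le[OF x(2)] by (intro mn_le) auto
      ultimately show "mn (s + x) (\<gamma> (b j)) \<le> min (F (s + x)) (F s + m)" using q by simp
    next
      obtain z where z: "s + x \<le> z" "z \<le> \<gamma> (b j)" "F z = mn (s + x) (\<gamma> (b j))"
        using mn_attained[OF s_le[OF x(2)]] .
      have "\<Gamma> h \<le> ereal (s + x)" using piece_h[OF x] by (simp add: piece_def)
      from lowest_valley[OF j this z(1,2)] show "min (F (s + x)) (F s + m) \<le> mn (s + x) (\<gamma> (b j))"
      proof
        assume "\<exists>q. num_up h < q \<and> q \<le> j \<and> F (\<gamma> (a q)) \<le> F z"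
        then obtain q where q: "num_up h < q" "q \<le> j" "F (\<gamma> (a q)) \<le> F z" by blast
        hence "q \<in> {r..j}" by (simp add: r_def)
        thus ?thesis using m_le[of q] q z by simp
      qed (use z in simp)
    qed
    have fo: "first_output j h i (ereal s) (ereal (gap j s)) =
      (if ereal m \<le> 0 then ereal s - ereal x1 - ereal (gap j s) / \<mu>t i
       else if - ((ereal (gap j s) - ereal m) / \<mu>t i) \<le> ereal m / \<mu>t h
         then ereal s - ereal x1 + ereal (gap j s) / (\<mu>t h - \<mu>t i)
       else ereal s - ereal x1 - (ereal (gap j s) - ereal m) / \<mu>t i)"
      unfolding first_output_def alg_a_interval[OF j h(1)] r_def[symmetric] Let_def
        chi_def[symmetric] Min_chi using rj by simp
    show ?thesis
    proof (cases "m \<le> 0")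
      case True
      \<comment> \<open>The lowest valley is not above \<open>F s\<close>, so it gives the minimum
        at \<open>s\<close>. It keeps doing so, since minima over shrinking intervals cannot
        decrease.\<close>
      have mn_const: "mn (s + x) (\<gamma> (b j)) = F s + m" if x: "0 \<le> x" "x \<le> p" for x
      proof (rule antisym)
        show "mn (s + x) (\<gamma> (b j)) \<le> F s + m" by (simp add: mn_eq[OF x])
        have "mn s (\<gamma> (b j)) \<le> mn (s + x) (\<gamma> (b j))" using x s_le[OF x(2)] by (intro mn_mono) auto
        thus "F s + m \<le> mn (s + x) (\<gamma> (b j))" using mn_eq[of 0] True p by simp
      qed
      have lin: "gap j (s + x) = gap j s - c * x" if "0 \<le> x" "x \<le> p" for x
        using gap_eq[OF that] gap_eq[of 0] mn_const[OF that] mn_const[of 0] p by simp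
      note cr = linear_crossing[OF j s p(1) sp lin c gap start]
      have "first_output j h i (ereal s) (ereal (gap j s)) = ereal (s - x1 + gap j s / c)"
        unfolding fo \<mu>t_i using True c by simp
      thus ?thesis using cr d0 c by (intro out[OF cr(1)]) auto
    next
      case False
      hence m: "0 < m" by simp
      \<comment> \<open>A fall on piece \<open>h\<close> would go below \<open>F s\<close>, which
        \<open>m > 0\<close> makes the minimum up to the ridge.\<close>
      have slope_h: "\<nu> \<le> \<mu> h"
      proof (rule ccontr)
        assume neg: "\<not> \<nu> \<le> \<mu> h"
        have "F (s + p) < F s" using F_h[of p] neg p by (simp add: mult_neg_pos)
        moreover have "mn s (\<gamma> (b j)) \<le> F (s + p)" using p sp by (intro mn_le) auto
        ultimately show False using mn_eq[of 0] m p by simp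
      qed
      define e where "e = \<mu> h - \<nu>"
      have e: "0 \<le> e" using slope_h by (simp add: e_def)
      have d_eq: "gap j s = F (s + L) - F s"
        using gap_eq[of 0] mn_eq[of 0] m p by simp
      have g: "gap j (s + x) = gap j s + F s - c * x - min (F s + e * x) (F s + m)"
        if x: "0 \<le> x" "x \<le> p" for x
        using gap_eq[OF x] mn_eq[OF x] F_h[OF x] d_eq by (simp add: e_def)
      \<comment> \<open>The gap is the maximum of two decreasing lines, one for the left end and one
        for the valley. The lower bounds give positivity before the output, and \<open>g3\<close>
        gives the sign at it.\<close>
      have g1: "gap j (s + x) \<ge> gap j s - (e + c) * x"
        and g2: "gap j (s + x) \<ge> gap j s - m - c * x"
        and g3: "gap j (s + x) = gap j s - (e + c) * x \<or> gap j (s + x) = gap j s - m - c * x"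
        if x: "0 \<le> x" "x \<le> p" for x
        unfolding g[OF x] min_def by (simp_all add: distrib_right)
      have ec: "0 < e + c" using e c by simp
      \<comment> \<open>The test is equivalent to
        \<open>(gap j s - m) / c \<le> gap j s / (e + c)\<close>, so the output is the larger of the
        zeros of the two lines. For \<open>e = 0\<close> the quotient by \<open>\<mu>t h\<close> is
        \<open>\<infinity>\<close> and the test succeeds.\<close>
      have cond: "- ((ereal (gap j s) - ereal m) / \<mu>t i) \<le> ereal m / \<mu>t h \<longleftrightarrow>
          (gap j s - m) * e \<le> m * c"
      proof (cases "e = 0")
        case True
        hence "ereal m / \<mu>t h = \<infinity>" using m by (simp add: \<mu>t_def e_def divide_ereal_def)
        thus ?thesis using True m c by simp
      next
        case False
        hence e0: "0 < e" using e by simp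
        have "- ((ereal (gap j s) - ereal m) / \<mu>t i) = ereal ((gap j s - m) / c)"
          unfolding \<mu>t_i using c by simp
        moreover have "ereal m / \<mu>t h = ereal (m / e)"
          unfolding \<mu>t_def e_def[symmetric] using e0 by simp
        ultimately show ?thesis using e0 c by (simp add: field_simps)
      qed
      show ?thesis
      proof (cases "(gap j s - m) * e \<le> m * c")
        case True
        define x where "x = gap j s / (e + c)"
        have x_eq: "gap j s = (e + c) * x" using ec by (simp add: x_def)
        have x0: "0 \<le> x" using d0 ec by (simp add: x_def)
        have xp: "x \<le> p" using g1[of p] gap p ec by (simp add: x_def field_simps)
        have "e * x \<le> m"
        proof -
          have "(e * x) * (e + c) \<le> m * (e + c)" using True by (simp add: x_eq algebra_simps)
          thus ?thesis using ec by simp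
        qed
        hence "gap j (s + x) \<le> 0" using g3[OF x0 xp] by (auto simp: x_eq algebra_simps)
        moreover have "0 < gap j (s + x')" if "0 \<le> x'" "x' < x" for x'
        proof -
          have "(e + c) * x' < (e + c) * x" using that ec by simp
          thus ?thesis using g1[of x'] that xp x_eq by simp
        qed
        ultimately have cr: "crossing j (s + x)"
          using crossing_in_segment[OF j s x0 s_le[OF xp]] start by blast
        have "first_output j h i (ereal s) (ereal (gap j s)) = ereal (s - x1 + x)"
          unfolding fo cond using True False ec
          by (simp add: \<mu>t_i \<mu>t_def x_def e_def c_def)
        thus ?thesis by (rule out[OF cr x0 xp])
      next
        case ne: False
        define x where "x = (gap j s - m) / c"
        have x_eq: "gap j s - m = c * x" using c by (simp add: x_def)
        have ex: "m < e * x" using ne c by (simp add: x_eq mult.commute mult.left_commute)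
        hence "0 < e * x" using m by simp
        hence x0: "0 \<le> x" using e by (simp add: zero_less_mult_iff)
        have xp: "x \<le> p" using g2[of p] gap p c by (simp add: x_def field_simps)
        have "gap j (s + x) \<le> 0" using g3[OF x0 xp] ex x_eq by (auto simp: algebra_simps)
        moreover have "0 < gap j (s + x')" if "0 \<le> x'" "x' < x" for x'
        proof -
          have "c * x' < c * x" using that c by simp
          thus ?thesis using g2[of x'] that xp x_eq by simp
        qed
        ultimately have cr: "crossing j (s + x)"
          using crossing_in_segment[OF j s x0 s_le[OF xp]] start by blast
        have "first_output j h i (ereal s) (ereal (gap j s)) = ereal (s - x1 + x)"
          unfolding fo cond using ne False c by (simp add: \<mu>t_i x_def)
        thus ?thesis by (rule out[OF cr x0 xp])
      qed
    qed
  qed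
qed

text \<open>For \<open>r \<le> k\<close>, \<open>u\<close> is the height above \<open>e\<close> at
  the left end of piece \<open>r\<close>. The loop inspects only right ends, which suffices because
  \<open>F\<close> is least at an end of each piece. The case \<open>r = k + 1\<close> is the
  exhausted loop, where only \<open>y = \<theta>\<close> could remain.\<close>

lemma overtaken_iff:
  assumes "1 \<le> r" "r \<le> k + 1" "k \<le> M" "\<Gamma> k < ereal \<theta>" "ereal \<theta> \<le> \<Gamma> (k + 1)"
    and "r \<le> k \<Longrightarrow> u = F (\<gamma> r) - e" "0 \<le> u" "r = k + 1 \<Longrightarrow> u = F \<theta> - e"
  shows "overtaken (ereal \<theta>) k r (ereal u) \<longleftrightarrow> (\<exists>y. \<Gamma> r \<le> ereal y \<and> y \<le> \<theta> \<and> F y < e)"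
  using assms
proof (induction "k + 1 - r" arbitrary: r u rule: less_induct)
  case less
  show ?case
  proof (cases "r \<le> k")
    case False
    hence r: "r = k + 1" using less.prems by simp
    have "\<not> (\<exists>y. \<Gamma> r \<le> ereal y \<and> y \<le> \<theta> \<and> F y < e)"
    proof
      assume "\<exists>y. \<Gamma> r \<le> ereal y \<and> y \<le> \<theta> \<and> F y < e"
      then obtain y where y: "\<Gamma> r \<le> ereal y" "y \<le> \<theta>" "F y < e" by auto
      hence "ereal \<theta> \<le> ereal y" using less.prems(5) r by (metis order_trans)
      hence "y = \<theta>" using y by simp
      thus False using less.prems r y by simp
    qed
    moreover have "\<not> overtaken (ereal \<theta>) k r (ereal u)"
      using False by (subst overtaken.simps) simp
    ultimately show ?thesis by blast
  next
    case True
    have rM: "r \<le> M" using True less.prems by simp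
    \<comment> \<open>The right end of piece \<open>r\<close>, cut off at \<open>\<theta>\<close> in
      the last round, so that one formula covers both updates of \<open>\<phi>\<close>.\<close>
    define w where "w = (if r < k then \<gamma> (r + 1) else \<theta>)"
    have gr: "\<gamma> r \<in> piece r" using \<gamma>_piece less.prems(1) rM by simp
    have wr: "w \<in> piece r" "\<gamma> r \<le> w"
      using \<gamma>_Suc_piece[of r] True less.prems rM \<gamma>_less[of r "r + 1"]
      by (auto simp: w_def piece_def \<Gamma>_real)
    have w\<theta>: "w \<le> \<theta>"
    proof (cases "r < k")
      case True
      have "\<Gamma> (r + 1) \<le> \<Gamma> k" using True by (intro \<Gamma>_mono) simp
      hence "\<Gamma> (r + 1) \<le> ereal \<theta>" using less.prems(4) by simp
      thus ?thesis using True less.prems(3) by (simp add: w_def \<Gamma>_real)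
    qed (simp add: w_def)
    have sum: "ereal u + (if r < k then \<mu>t r * (\<Gamma> (r + 1) - \<Gamma> r) else \<mu>t r * (ereal \<theta> - \<Gamma> r))
        = ereal (F w - e)"
      using \<mu>t_diff[OF rM gr wr(1)] True less.prems rM by (auto simp: w_def \<Gamma>_real)
    have mnw: "mn (\<gamma> r) w = min (F (\<gamma> r)) (F w)" using mn_piece[OF rM gr wr] .
    have ge: "e \<le> F (\<gamma> r)" using less.prems True by simp
    have ov: "overtaken (ereal \<theta>) k r (ereal u) \<longleftrightarrow>
        F w < e \<or> overtaken (ereal \<theta>) k (r + 1) (ereal (F w - e))"
      using True by (subst overtaken.simps) (simp add: sum Let_def)
    show ?thesis
    proof (cases "F w < e")
      case True
      have "\<Gamma> r \<le> ereal w" using wr by (simp add: piece_def)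
      thus ?thesis using ov True w\<theta> by blast
    next
      case False
      have IH: "overtaken (ereal \<theta>) k (r + 1) (ereal (F w - e)) \<longleftrightarrow>
          (\<exists>y. \<Gamma> (r + 1) \<le> ereal y \<and> y \<le> \<theta> \<and> F y < e)"
        by (rule less.hyps) (use less.prems True False in \<open>auto simp: w_def\<close>)
      have "(\<exists>y. \<Gamma> (r + 1) \<le> ereal y \<and> y \<le> \<theta> \<and> F y < e) \<longleftrightarrow>
          (\<exists>y. \<Gamma> r \<le> ereal y \<and> y \<le> \<theta> \<and> F y < e)" (is "?A \<longleftrightarrow> ?B")
      proof
        show "?A \<Longrightarrow> ?B" using \<Gamma>_mono[of r "r + 1"] by (auto intro: order_trans)
        assume ?B
        then obtain y where y: "\<Gamma> r \<le> ereal y" "y \<le> \<theta>" "F y < e" by auto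
        \<comment> \<open>Both ends of this stretch are at least \<open>e\<close>, so a lower point
          must come after \<open>w\<close>.\<close>
        have "\<not> y \<le> w"
        proof
          assume "y \<le> w"
          hence "mn (\<gamma> r) w \<le> F y" using y less.prems(1) rM by (intro mn_le) (simp_all add: \<Gamma>_real)
          thus False using mnw ge False y by simp
        qed
        hence "r < k" "w < y" using y by (auto simp: w_def split: if_splits)
        hence "\<Gamma> (r + 1) \<le> ereal y" using less.prems(3) by (simp add: w_def \<Gamma>_real)
        thus ?A using y by blast
      qed
      thus ?thesis using ov False IH by simp
    qed
  qed
qed

text \<open>The right end has reached the valley, so \<open>rend\<close> rests there and only the
  left end matters. The gap changes sign when \<open>F\<close> at the left end climbs to the valley
  level \<open>A\<close>; the inner loop then decides whether a lower point beyond the valley is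
  already in the window.\<close>

lemma second_output_correct:
  assumes j: "1 \<le> j" "j \<le> card down_set"
    and h: "h < b j" "\<Gamma> h \<le> ereal s" "s < \<gamma> (h + 1)"
    and s: "\<gamma> (b j) - L \<le> s" "next_up j \<le> M" "\<gamma> (next_up j) \<le> s + L"
    and pos: "0 < gap j s" and gap: "gap j (\<gamma> (h + 1)) \<le> 0"
  shows "correct_output j (second_output j h (ereal s) (ereal (gap j s)))"
proof -
  have bj: "1 \<le> b j" "b j \<le> M" using b_bounds[OF j] by auto
  have hM: "h + 1 \<le> M" using h bj by simp
  have hb: "\<gamma> (h + 1) \<le> \<gamma> (b j)"
    using \<gamma>_less[of "h + 1" "b j"] h bj by (cases "h + 1 = b j") auto
  define A where "A = F (\<gamma> (next_up j))"
  define K where "K = mn (\<gamma> (h + 1)) (\<gamma> (b j))"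
  define e where "e = \<mu> h - \<nu>"
  have piece_h: "u \<in> piece h" if "s \<le> u" "u \<le> \<gamma> (h + 1)" for u
  proof -
    have "\<Gamma> h \<le> ereal u" by (rule order_trans[OF h(2)]) (use that in simp)
    thus ?thesis using that hM by (simp add: piece_def \<Gamma>_real)
  qed
  have K_le: "K \<le> F (\<gamma> (h + 1))" unfolding K_def using hb by (intro mn_le) auto
  have gap_eq: "gap j u = A - min (F u) K" if u: "s \<le> u" "u \<le> \<gamma> (h + 1)" for u
  proof -
    have "mn u (\<gamma> (h + 1)) = min (F u) (F (\<gamma> (h + 1)))"
      using u h(3) hM by (intro mn_piece[of h] piece_h) auto
    hence "mn u (\<gamma> (b j)) = min (F u) K"
      using mn_split[OF u(2) hb] K_le by (simp add: K_def)
    moreover have "rend j u = \<gamma> (next_up j)" using s u by (simp add: rend_def)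
    ultimately show ?thesis by (simp add: gap_def A_def)
  qed
  \<comment> \<open>Since \<open>K\<close> is at most \<open>F\<close> at the next breakpoint, the
    gap there is \<open>A - K\<close>. So nothing from that breakpoint to the ridge is below the
    valley.\<close>
  have AK: "A \<le> K" using gap gap_eq[of "\<gamma> (h + 1)"] h(3) K_le by simp
  have d: "gap j s = A - F s" using pos gap_eq[of s] h(3) AK by simp
  have F_h: "F u = F s + e * (u - s)" if "s \<le> u" "u \<le> \<gamma> (h + 1)" for u
    using F_diff[OF _ piece_h[of s] piece_h[OF that]] h(3) hM by (simp add: e_def)
  have "0 < e * (\<gamma> (h + 1) - s)" using F_h[of "\<gamma> (h + 1)"] h(3) AK K_le d pos by simp
  hence e: "0 < e" using h(3) by (simp add: zero_less_mult_iff)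
  define x where "x = gap j s / e"
  have x_eq: "gap j s = e * x" using e by (simp add: x_def)
  have x0: "0 \<le> x" using pos e by (simp add: x_def)
  have "e * x \<le> e * (\<gamma> (h + 1) - s)"
    using F_h[of "\<gamma> (h + 1)"] h(3) AK K_le d x_eq by simp
  hence xp: "s + x \<le> \<gamma> (h + 1)" using e by simp
  have "F (s + x) = A" using F_h[of "s + x"] x0 xp d x_eq by simp
  hence "gap j (s + x) \<le> 0" using gap_eq[of "s + x"] x0 xp AK by simp
  moreover have "0 < gap j (s + x')" if "0 \<le> x'" "x' < x" for x'
  proof -
    have "e * x' < e * x" using that e by simp
    thus ?thesis using gap_eq[of "s + x'"] F_h[of "s + x'"] that xp d x_eq by simp
  qed
  ultimately have cr: "crossing j (s + x)"
    using crossing_in_segment[OF j s(1) x0] xp hb pos by auto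
  define \<theta> where "\<theta> = s + x + L"
  have \<tau>: "ereal s + ereal (gap j s) / \<mu>t h = ereal (s + x)"
    using e by (simp add: \<mu>t_def x_def e_def)
  have \<theta>: "ereal (s + x) + ereal (x2 - x1) = ereal \<theta>" by (simp add: \<theta>_def L_def)
  obtain k where k: "k \<le> M" "\<Gamma> k < ereal \<theta>" "ereal \<theta> \<le> \<Gamma> (k + 1)" using right_closed_piece .
  have the_k: "(THE k. k \<le> M \<and> \<Gamma> k < ereal \<theta> \<and> ereal \<theta> \<le> \<Gamma> (k + 1)) = k"
  proof (rule the_equality)
    fix k' assume k': "k' \<le> M \<and> \<Gamma> k' < ereal \<theta> \<and> ereal \<theta> \<le> \<Gamma> (k' + 1)"
    hence "\<Gamma> k' < \<Gamma> (k + 1)" "\<Gamma> k < \<Gamma> (k' + 1)" using k by (auto intro: less_le_trans)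
    thus "k' = k" using \<Gamma>_less_iff k k' by simp
  qed (use k in simp)
  have nu: "\<Gamma> (next_up j) = ereal (\<gamma> (next_up j))" using next_up_pos s(2) by (simp add: \<Gamma>_real)
  have A_le: "\<gamma> (next_up j) \<le> \<theta>" using s x0 by (simp add: \<theta>_def)
  have "overtaken (ereal \<theta>) k (next_up j) 0 \<longleftrightarrow> skipped j (s + x)"
  proof (cases "next_up j \<le> k + 1")
    case True
    have "overtaken (ereal \<theta>) k (next_up j) (ereal 0) \<longleftrightarrow>
        (\<exists>y. \<Gamma> (next_up j) \<le> ereal y \<and> y \<le> \<theta> \<and> F y < A)"
    proof (rule overtaken_iff[OF next_up_pos True k])
      \<comment> \<open>Here \<open>\<theta>\<close> is the valley itself, and the inner loop is
        empty.\<close>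
      assume "next_up j = k + 1"
      hence "\<theta> = \<gamma> (next_up j)" using k(3) nu A_le by simp
      thus "0 = F \<theta> - A" by (simp add: A_def)
    qed (auto simp: A_def)
    also have "\<dots> \<longleftrightarrow> skipped j (s + x)"
      unfolding skipped_def nu \<theta>_def[symmetric] A_def[symmetric] using s(2)
      by (auto simp: A_def order_le_less)
    finally show ?thesis by (simp add: zero_ereal_def)
  next
    case False
    have "\<Gamma> (k + 1) < \<Gamma> (next_up j)" using False next_up_le[of j] by (intro \<Gamma>_less) auto
    hence "\<theta> < \<gamma> (next_up j)" using k(3) nu by (metis ereal_less_eq(3) leD not_le_imp_less order_le_less_trans)
    thus ?thesis using A_le by simp
  qed
  moreover have "second_output j h (ereal s) (ereal (gap j s)) =
      (if overtaken (ereal \<theta>) k (next_up j) 0 then \<infinity> else ereal (s + x) - ereal x1)"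
    unfolding second_output_def Let_def \<tau> \<theta> the_k alg_a_Suc[OF j] ..
  ultimately show ?thesis using cr by (auto simp: correct_output_def)
qed

section \<open>Invariants of the two loops\<close>

lemma gap_end_neg:
  assumes j: "1 \<le> j" "j \<le> card down_set"
  shows "gap j (\<gamma> (b j)) < 0"
proof -
  have "\<gamma> (b j) < rend j (\<gamma> (b j))" using \<gamma>_b_less[OF j] L_pos by (auto simp: rend_def)
  hence "F (rend j (\<gamma> (b j))) < F (\<gamma> (b j))" using j rend_le by (intro F_after) auto
  thus ?thesis by (simp add: gap_def mn_self)
qed

text \<open>The invariant: \<open>d\<close> is the positive gap at \<open>s\<close>, and the window
  contains the next valley. Each round moves the left end to the next breakpoint, where
  \<open>\<delta>\<close> is the gap.\<close>

lemma second_loop_correct: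
  assumes j: "1 \<le> j" "j \<le> card down_set"
    and "h < b j" "\<Gamma> h \<le> ereal s" "s < \<gamma> (h + 1)"
    and "\<gamma> (b j) - L \<le> s" "next_up j \<le> M" "\<gamma> (next_up j) \<le> s + L" "0 < gap j s"
  shows "correct_output j (second_loop j h (ereal s) (ereal (gap j s)))"
  using assms(3-)
proof (induction "b j - h" arbitrary: h s rule: less_induct)
  case less
  have bj: "1 \<le> b j" "b j \<le> M" using b_bounds[OF j] by auto
  have hM: "h + 1 \<le> M" using less.prems bj by simp
  define s' where "s' = \<gamma> (h + 1)"
  have \<psi>: "\<Gamma> (h + 1) - ereal s = ereal (s' - s)" using hM by (simp add: \<Gamma>_real s'_def)
  have s': "ereal s + ereal (s' - s) = ereal s'" by simp
  have hb: "s' \<le> \<gamma> (b j)"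
    using \<gamma>_less[of "h + 1" "b j"] less.prems bj by (cases "h + 1 = b j") (auto simp: s'_def)
  have left: "(if h + 1 < b j then left_part j (h + 1) (ereal s') else 0) =
      ereal (F (\<gamma> (b j)) - mn s' (\<gamma> (b j)))"
  proof (cases "h + 1 < b j")
    case True
    hence "s' \<in> piece (h + 1)" unfolding s'_def using bj by (intro \<gamma>_piece) auto
    thus ?thesis using left_part_eq[OF j, of "h + 1" s'] True by simp
  next
    case False
    hence "h + 1 = b j" using less.prems(1) by simp
    hence "s' = \<gamma> (b j)" unfolding s'_def by (rule arg_cong)
    thus ?thesis using False by (simp add: mn_self)
  qed
  have seg: "seg_sum (b j) (alg_a j (j + 1)) = ereal (F (\<gamma> (next_up j)) - F (\<gamma> (b j)))"
    using alg_a_Suc[OF j] b_less_next_up[OF j] bj less.prems by (simp add: seg_sum_eq)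
  have "rend j s' = \<gamma> (next_up j)" using less.prems by (simp add: rend_def s'_def)
  hence \<delta>: "(if h + 1 < b j then left_part j (h + 1) (ereal s') else 0) +
      seg_sum (b j) (alg_a j (j + 1)) = ereal (gap j s')"
    unfolding left seg by (simp add: gap_def)
  have step: "second_loop j h (ereal s) (ereal (gap j s)) =
      (if gap j s' \<le> 0 then second_output j h (ereal s) (ereal (gap j s))
       else second_loop j (h + 1) (ereal s') (ereal (gap j s')))"
    using less.prems(1)
    by (subst second_loop.simps) (simp only: Let_def \<psi> s' \<delta> if_True ereal_le_zero_iff)
  show ?case
  proof (cases "gap j s' \<le> 0")
    case True
    thus ?thesis using step second_output_correct[OF j less.prems] by (simp add: s'_def)
  next
    case False
    \<comment> \<open>At the ridge the gap is negative, so a positive gap means that the ridge is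
      not yet reached. Hence the loop never yields \<open>undefined\<close>.\<close>
    hence "h + 1 \<noteq> b j" using gap_end_neg[OF j] by (auto simp: s'_def)
    hence hlt: "h + 1 < b j" using less.prems(1) by simp
    have "correct_output j (second_loop j (h + 1) (ereal s') (ereal (gap j s')))"
    proof (rule less.hyps)
      show "s' < \<gamma> (h + 1 + 1)" unfolding s'_def using hlt bj by (intro \<gamma>_less) auto
    qed (use hlt less.prems False hM in \<open>auto simp: s'_def \<Gamma>_real\<close>)
    thus ?thesis using step False by simp
  qed
qed

text \<open>The invariant: the window ends lie in the half-open pieces \<open>h\<close> and
  \<open>i\<close>, and \<open>d\<close> is the gap at \<open>s\<close>, positive except possibly at
  the start. When \<open>i\<close> reaches \<open>next_up j\<close>, the right end is at the valley
  and the second loop takes over.\<close>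

lemma first_loop_correct:
  assumes j: "1 \<le> j" "j \<le> card down_set"
    and "h < b j" "\<Gamma> h \<le> ereal s" "s < \<gamma> (h + 1)" "\<gamma> (b j) - L \<le> s"
    and "b j \<le> i" "i \<le> next_up j" "i \<le> M" "\<Gamma> i \<le> ereal (s + L)" "ereal (s + L) < \<Gamma> (i + 1)"
    and "i = next_up j \<Longrightarrow> s + L = \<gamma> i"
    and "0 < gap j s \<or> s = \<gamma> (b j) - L \<and> i < next_up j"
  shows "correct_output j (first_loop j h i (ereal s) (ereal (s + L)) (ereal (gap j s)))"
  using assms(3-)
proof (induction "b j - h + (next_up j - i)" arbitrary: h i s rule: less_induct)
  case less
  have bj: "1 \<le> b j" "b j \<le> M" using b_bounds[OF j] by auto
  have hM: "h + 1 \<le> M" using less.prems bj by simp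
  show ?case
  proof (cases "i = next_up j")
    case True
    hence "correct_output j (second_loop j h (ereal s) (ereal (gap j s)))"
      using less.prems by (intro second_loop_correct[OF j]) auto
    thus ?thesis using True alg_a_Suc[OF j] by (subst first_loop.simps) simp
  next
    case False
    hence i: "i < next_up j" using less.prems by simp
    \<comment> \<open>The real value of \<open>\<psi>\<close>: for \<open>i = M\<close> the right
      end meets no further breakpoint, and only the left distance counts.\<close>
    define p where "p = (if i < M then min (\<gamma> (h + 1) - s) (\<gamma> (i + 1) - (s + L)) else \<gamma> (h + 1) - s)"
    have \<psi>: "min (\<Gamma> (h + 1) - ereal s) (\<Gamma> (i + 1) - ereal (s + L)) = ereal p"
      using hM less.prems(7) by (auto simp: p_def ext_bp_def min_def)
    have p0: "0 < p" using less.prems by (auto simp: p_def ext_bp_def)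
    have p_le: "s + p \<le> \<gamma> (h + 1)" "ereal (s + p + L) \<le> \<Gamma> (i + 1)"
      using less.prems by (auto simp: p_def ext_bp_def)
    define s' where "s' = s + p"
    define h' where "h' = (if \<Gamma> (h + 1) - ereal s \<le> \<Gamma> (i + 1) - ereal (s + L) then h + 1 else h)"
    define i' where "i' = (if \<Gamma> (h + 1) - ereal s \<ge> \<Gamma> (i + 1) - ereal (s + L) then i + 1 else i)"
    have h': "h' = h + 1 \<and> s' = \<gamma> (h + 1) \<or> h' = h \<and> s' < \<gamma> (h + 1)"
      using hM less.prems(7) by (auto simp: h'_def s'_def p_def ext_bp_def split: if_splits)
    have i': "i' = i + 1 \<and> i < M \<and> s' + L = \<gamma> (i + 1) \<or> i' = i \<and> ereal (s' + L) < \<Gamma> (i + 1)"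
      using hM less.prems(7) by (auto simp: i'_def s'_def p_def ext_bp_def split: if_splits)
    have hi: "h' = h + 1 \<or> i' = i + 1" by (auto simp: h'_def i'_def)
    have hb: "\<gamma> (h + 1) \<le> \<gamma> (b j)"
      using \<gamma>_less[of "h + 1" "b j"] less.prems bj by (cases "h + 1 = b j") auto
    have s_less: "s < s'" using p0 by (simp add: s'_def)
    have \<Gamma>_h: "\<Gamma> h \<le> ereal s'" using less.prems(2) s_less by (meson ereal_less_eq(3) less_imp_le order_trans)
    have \<Gamma>_i: "\<Gamma> i \<le> ereal (s' + L)"
      by (rule order_trans[OF less.prems(8)]) (use s_less in simp)
    have \<Gamma>_h': "\<Gamma> h' \<le> ereal s'" using h' \<Gamma>_h hM by (auto simp: \<Gamma>_real)
    have \<Gamma>_i': "\<Gamma> i' \<le> ereal (s' + L)" using i' \<Gamma>_i by (auto simp: \<Gamma>_real)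
    have h'_b: "h' \<le> b j" using h' less.prems by auto
    have i'_M: "i' \<le> M" "i' \<le> next_up j" "b j \<le> i'" using i' less.prems i by auto
    have left: "left_part j h' (ereal s') = ereal (F (\<gamma> (b j)) - mn s' (\<gamma> (b j)))"
    proof (cases "h' = b j")
      case True
      hence "s' = \<gamma> (b j)" using h' less.prems(1) by auto
      thus ?thesis using True left_part_eq[OF j, of h' s'] by simp
    next
      case False
      hence lt: "h' < b j" using h'_b by simp
      have "s' \<le> \<gamma> (h' + 1)" using h' \<gamma>_less[of "h + 1" "h + 2"] lt bj by auto
      hence "s' \<in> piece h'" using \<Gamma>_h' lt bj by (simp add: piece_def \<Gamma>_real)
      thus ?thesis using lt left_part_eq[OF j, of h' s'] by simp
    qed
    have less_i': "ereal (s' + L) < \<Gamma> (i' + 1)"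
      using i' \<Gamma>_less[of "i + 1" "i + 2"] by (auto simp: \<Gamma>_real)
    have right: "right_part j i' (ereal (s' + L)) = ereal (F (s' + L) - F (\<gamma> (b j)))"
      using right_part_eq[OF j i'_M(3,1), of "s' + L"] less_i' \<Gamma>_i' i' i
      by (auto simp: piece_def)
    have "ereal (s' + L) \<le> \<Gamma> (next_up j)"
      using p_le(2) \<Gamma>_mono[of "i + 1" "next_up j"] i by (auto simp: s'_def intro: order_trans)
    hence \<delta>: "left_part j h' (ereal s') + right_part j i' (ereal (s' + L)) = ereal (gap j s')"
      unfolding left right by (simp add: gap_def rend_inner)
    have sums: "ereal s + ereal p = ereal s'" "ereal (s + L) + ereal p = ereal (s' + L)"
      by (simp_all add: s'_def)
    have step: "first_loop j h i (ereal s) (ereal (s + L)) (ereal (gap j s)) =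
        (if gap j s' \<le> 0 then first_output j h i (ereal s) (ereal (gap j s))
         else first_loop j h' i' (ereal s') (ereal (s' + L)) (ereal (gap j s')))"
      using less.prems(1) i alg_a_Suc[OF j]
      by (subst first_loop.simps)
        (simp only: Let_def \<psi> sums h'_def[symmetric] i'_def[symmetric] \<delta> simp_thms if_True
          ereal_le_zero_iff)
    show ?thesis
    proof (cases "gap j s' \<le> 0")
      case True
      have "correct_output j (first_output j h i (ereal s) (ereal (gap j s)))"
        by (rule first_output_correct[OF j less.prems(1,2,5) i less.prems(8) p0 p_le])
          (use True less.prems in \<open>auto simp: s'_def\<close>)
      thus ?thesis using step True by simp
    next
      case False
      hence "h' \<noteq> b j" using gap_end_neg[OF j] h' less.prems(1) by auto
      hence hlt: "h' < b j" using h'_b by simp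
      have "correct_output j (first_loop j h' i' (ereal s') (ereal (s' + L)) (ereal (gap j s')))"
      proof (rule less.hyps)
        show "b j - h' + (next_up j - i') < b j - h + (next_up j - i)"
          using hi h' i' less.prems(1) i by auto
        show "s' < \<gamma> (h' + 1)" using h' \<gamma>_less[of "h + 1" "h + 2"] hlt bj by auto
        show "i' = next_up j \<Longrightarrow> s' + L = \<gamma> i'" using i' i by auto
      qed (use hlt i'_M \<Gamma>_h' \<Gamma>_i' less_i' False less.prems(4) s_less in auto)
      thus ?thesis using step False by simp
    qed
  qed
qed

lemma \<omega>_correct:
  assumes j: "1 \<le> j" "j \<le> card down_set"
  shows "correct_output j (\<omega> j)"
proof -
  have bj: "1 \<le> b j" "b j \<le> M" using b_bounds[OF j] by auto
  define s where "s = \<gamma> (b j) - L"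
  obtain h where h: "h \<le> M" "\<Gamma> h \<le> ereal s" "ereal s < \<Gamma> (h + 1)" using left_closed_piece .
  have "\<Gamma> h < \<Gamma> (b j)" using h(2) bj L_pos by (auto simp: \<Gamma>_real s_def intro: le_less_trans)
  hence hb: "h < b j" using \<Gamma>_less_iff[of h "b j"] h bj by simp
  have the_h: "(THE h. \<Gamma> h \<le> ereal s \<and> ereal s < \<Gamma> (h + 1)) = h"
  proof (rule the_equality)
    fix h' assume h': "\<Gamma> h' \<le> ereal s \<and> ereal s < \<Gamma> (h' + 1)"
    have "h' \<le> M" using h' by (force simp: ext_bp_def split: if_splits)
    moreover have "\<Gamma> h < \<Gamma> (h' + 1)" "\<Gamma> h' < \<Gamma> (h + 1)" using h h' by (auto intro: le_less_trans)
    ultimately show "h' = h" using \<Gamma>_less_iff h by simp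
  qed (use h in simp)
  \<comment> \<open>At the start the right end is on the ridge itself, so the initial
    \<open>d\<close>, which has no right part, is already the gap.\<close>
  have "rend j s = \<gamma> (b j)" using \<gamma>_b_less[OF j] by (simp add: rend_def s_def)
  hence g: "left_part j h (ereal s) = ereal (gap j s)"
    using left_part_eq[OF j, of h s] hb h by (simp add: gap_def piece_def)
  have sL: "\<gamma> (b j) = s + L" by (simp add: s_def)
  have "\<omega> j = first_loop j h (b j) (ereal s) (ereal (s + L)) (ereal (gap j s))"
    unfolding \<omega>_def L_def[symmetric] s_def[symmetric] Let_def the_h g
    by (simp add: s_def)
  moreover have "correct_output j \<dots>"
  proof (rule first_loop_correct[OF j hb h(2)])
    show "s < \<gamma> (h + 1)" using h hb bj by (simp add: \<Gamma>_real)
    show "ereal (s + L) < \<Gamma> (b j + 1)"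
      using \<Gamma>_less[of "b j" "b j + 1"] bj by (simp add: \<Gamma>_real sL)
  qed (use b_less_next_up[OF j] bj sL in \<open>auto simp: s_def \<Gamma>_real\<close>)
  ultimately show ?thesis by simp
qed

subsection \<open>The optimal value\<close>

lemma sorted_finite_idx: "sorted_wrt (<) finite_idx"
  unfolding finite_idx_def by (intro sorted_wrt_filter sorted_wrt_upt)

lemma set_finite_idx: "set finite_idx = {j. 1 \<le> j \<and> j \<le> card down_set \<and> \<bar>\<omega> j\<bar> \<noteq> \<infinity>}"
  by (auto simp: finite_idx_def)

lemma l_in: "1 \<le> q \<Longrightarrow> q \<le> Q \<Longrightarrow> l q \<in> set finite_idx"
  by (simp add: l_def Q_def)

lemma l_le_card: "q \<le> Q \<Longrightarrow> l q \<le> card down_set"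
  using l_in[of q] by (cases "q = 0") (auto simp: l_def set_finite_idx)

lemma l_less: "q < q' \<Longrightarrow> q' \<le> Q \<Longrightarrow> l q < l q'"
proof -
  assume q: "q < q'" "q' \<le> Q"
  show ?thesis
  proof (cases "q = 0")
    case True
    thus ?thesis using l_in[of q'] q by (simp add: l_def set_finite_idx)
  next
    case False
    thus ?thesis using q by (auto simp: l_def Q_def intro!: sorted_wrt_nth_less[OF sorted_finite_idx])
  qed
qed

text \<open>A crossing is fixed for every ridge, also where \<open>\<omega> j = \<infinity>\<close>,
  because \<open>window_min\<close> asks for all of them.\<close>

definition \<sigma> :: "nat \<Rightarrow> real" where
  "\<sigma> j = (SOME s. crossing j s \<and> \<omega> j = (if skipped j s then \<infinity> else ereal (s - x1)))"

lemma \<sigma>: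
  assumes "1 \<le> j" "j \<le> card down_set"
  shows "crossing j (\<sigma> j)" "\<omega> j = (if skipped j (\<sigma> j) then \<infinity> else ereal (\<sigma> j - x1))"
  using someI_ex[OF \<omega>_correct[OF assms, unfolded correct_output_def]]
  unfolding \<sigma>_def[symmetric] by auto

lemma tstar_eq:
  assumes "1 \<le> q" "q \<le> Q"
  shows "tstar q = ereal (\<sigma> (l q) - x1)" "\<not> skipped (l q) (\<sigma> (l q))"
  using l_in[OF assms] \<sigma>[of "l q"] assms by (auto simp: tstar_def set_finite_idx split: if_splits)

lemma tstar_mono:
  assumes "q \<le> q'" "q' \<le> Q"
  shows "tstar q \<le> tstar q'"
proof (cases "q = 0 \<or> q = q'")
  case False
  hence q: "1 \<le> q" "q \<le> Q" "1 \<le> q'" "q < q'" using assms by auto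
  have l: "1 \<le> l q" "l q \<le> card down_set" "1 \<le> l q'" "l q' \<le> card down_set" 
    using l_in[of q] l_in[of q'] q assms by (auto simp: set_finite_idx)
  have "\<sigma> (l q) \<le> \<sigma> (l q')"
    using crossing_mono[OF \<sigma>(1)[OF l(1,2)] \<sigma>(1)[OF l(3,4)] tstar_eq(2)[OF q(1,2)] l(1) _ l(4)]
      l_less[OF q(4) assms(2)] by simp
  thus ?thesis using tstar_eq(1) q assms by simp
qed (auto simp: tstar_def)

definition region :: "nat \<Rightarrow> real \<Rightarrow> bool" where
  "region q t \<longleftrightarrow> q \<le> Q \<and> tstar q \<le> ereal t \<and> (q < Q \<longrightarrow> ereal t < tstar (q + 1))"

text \<open>Take the largest \<open>q\<close> with \<open>tstar q \<le> ereal t\<close>; the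
  convention \<open>tstar 0 = -\<infinity>\<close> provides one, also for
  \<open>Q = 0\<close>.\<close>

lemma region_exists: obtains q where "region q t"
proof -
  define q where "q = Max {q. q \<le> Q \<and> tstar q \<le> ereal t}"
  have fin: "finite {q. q \<le> Q \<and> tstar q \<le> ereal t}" by auto
  have "0 \<in> {q. q \<le> Q \<and> tstar q \<le> ereal t}" by (simp add: tstar_def)
  hence q: "q \<in> {q. q \<le> Q \<and> tstar q \<le> ereal t}" unfolding q_def using fin by (intro Max_in) auto
  have "ereal t < tstar (q + 1)" if "q < Q"
  proof (rule ccontr)
    assume "\<not> ereal t < tstar (q + 1)"
    hence "q + 1 \<in> {q. q \<le> Q \<and> tstar q \<le> ereal t}" using that by auto
    hence "q + 1 \<le> q" unfolding q_def by (rule Max_ge[OF fin])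
    thus False by simp
  qed
  hence "region q t" using q by (simp add: region_def)
  thus thesis by (rule that)
qed

section \<open>The minimizer as a valley clamped to the window\<close>

definition clamp :: "nat \<Rightarrow> real \<Rightarrow> real" where
  "clamp j t = (if j < card up_set then
      (let G = \<gamma> (a (j + 1)) in if t < G - x2 then x2 else if t < G - x1 then - t + G else x1)
    else x2)"

text \<open>The case distinctions in \<open>x_s\<close>, \<open>x_mid\<close> and \<open>x_e\<close>
  only remove branches that cannot occur for \<open>t\<close> in the region, so all three agree
  there with the same clamped valley.\<close>

lemma x_circ_region:
  assumes "region q t"
  shows "x_circ t = clamp (l q) t"
proof -
  have q: "q \<le> Q" "tstar q \<le> ereal t" "q < Q \<Longrightarrow> ereal t < tstar (q + 1)"
    using assms by (auto simp: region_def)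
  have card: "l q < card up_set" if "q < Q"
    using l_less[of q "q + 1"] l_le_card[of "q + 1"] card_le that by simp
  show ?thesis
  proof (cases "q = Q")
    case True
    have "x_circ t = x_e t"
    proof (cases "Q = 0")
      case False
      have "\<not> ereal t < tstar 1" using order_trans[OF tstar_mono[of 1 Q], of "ereal t"] q True False by (simp add: not_less)
      thus ?thesis using q True by (simp add: x_circ_def)
    qed (simp add: x_circ_def)
    moreover have "\<not> t < \<gamma> (a (l Q + 1)) - x2" if "\<not> tstar Q < ereal (\<gamma> (a (l Q + 1)) - x2)"
      using that q(2) True order_trans[of "ereal (\<gamma> (a (l Q + 1)) - x2)" "tstar Q" "ereal t"]
      by (auto simp: not_less)
    ultimately show ?thesis using True by (auto simp: x_e_def clamp_def Let_def)
  next
    case False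
    hence qQ: "q < Q" using q by simp
    have t: "ereal t < tstar (q + 1)" using q qQ by simp
    have x1G: "t < G - x1" if "\<not> ereal (G - x1) < tstar (q + 1)" for G
      using less_le_trans[OF t, of "ereal (G - x1)"] that by (simp add: not_less)
    have tQ: "\<not> tstar Q \<le> ereal t" using less_le_trans[OF t tstar_mono[of "q + 1" Q]] qQ by (simp add: not_le)
    show ?thesis
    proof (cases "q = 0")
      case True
      thus ?thesis using t qQ x1G[of "\<gamma> (a 1)"] card[OF qQ]
        by (auto simp: x_circ_def x_s_def clamp_def Let_def l_def)
    next
      case nz: False
      have "(THE q. q \<in> {1..<Q} \<and> tstar q \<le> ereal t \<and> ereal t < tstar (q + 1)) = q"
      proof (rule the_equality)
        fix q' assume q': "q' \<in> {1..<Q} \<and> tstar q' \<le> ereal t \<and> ereal t < tstar (q' + 1)"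
        have "\<not> q' < q" using order_trans[OF tstar_mono[of "q' + 1" q] q(2)] q q' by auto
        moreover have "\<not> q < q'" using less_le_trans[OF t tstar_mono[of "q + 1" q']] q' by auto
        ultimately show "q' = q" by simp
      qed (use nz qQ q t in auto)
      moreover have "\<not> ereal t < tstar 1"
        using order_trans[OF tstar_mono[of 1 q] q(2)] q nz by (simp add: not_less)
      ultimately have "x_circ t = x_mid q t" using tQ qQ by (simp add: x_circ_def)
      moreover have "x_mid q t = clamp (l q) t"
      proof -
        define G where "G = \<gamma> (a (l q + 1))"
        have lo: "\<not> t < G - x2" if "\<not> tstar q < ereal (G - x2)"
          using order_trans[of "ereal (G - x2)" "tstar q" "ereal t"] q(2) that by (simp add: not_less)
        show ?thesis
          using card[OF qQ] lo x1G[of G] x1_less_x2 unfolding x_mid_def clamp_def Let_def G_def[symmetric]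
          by (cases "tstar q < ereal (G - x2)"; cases "ereal (G - x1) < tstar (q + 1)") (simp_all flip: not_less)
      qed
      ultimately show ?thesis by simp
    qed
  qed
qed

lemma clamp_bounds: "x1 \<le> clamp j t" "clamp j t \<le> x2"
  using x1_less_x2 by (auto simp: clamp_def Let_def)

lemma x_circ_bounds: "x1 \<le> x_circ t" "x_circ t \<le> x2"
proof -
  obtain q where "region q t" using region_exists .
  thus "x1 \<le> x_circ t" "x_circ t \<le> x2" using x_circ_region clamp_bounds by auto
qed

lemma ramp_eq: "x1 \<le> x \<Longrightarrow> x \<le> x2 \<Longrightarrow> ramp x1 x2 \<nu> x = \<nu> * (x2 - x)"
  by (auto simp: ramp_def algebra_simps)

text \<open>In the coordinate \<open>x + t\<close> the clamped valley is the candidate of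
  \<open>window_min\<close>. With no next valley, both sides are the right end of the
  window.\<close>

lemma clamp_eq: "clamp j t + t = max (t + x1) (rend j (t + x1))"
proof (cases "j < card up_set")
  case True
  hence "next_up j = a (j + 1)" "a (j + 1) \<le> M"
    using a_in_up_set[of "j + 1"] by (auto simp: next_up_def up_set_def)
  thus ?thesis using True x1_less_x2 by (auto simp: clamp_def rend_def L_def Let_def)
next
  case False
  thus ?thesis using x1_less_x2 by (auto simp: clamp_def rend_def L_def next_up_def)
qed

section \<open>Optimality, monotonicity and continuity of the value\<close>

definition optval :: "real \<Rightarrow> real" where
  "optval t = f (x_circ t + t) + ramp x1 x2 \<nu> (x_circ t)"

lemma optval_eq: "optval t = f (x_circ t + t) + \<nu> * (x2 - x_circ t)"
  by (simp add: optval_def ramp_eq x_circ_bounds)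

lemma optval_minimal:
  assumes "x1 \<le> x" "x \<le> x2"
  shows "optval t \<le> f (x + t) + \<nu> * (x2 - x)"
proof -
  obtain q where q: "region q t" using region_exists .
  have qQ: "q \<le> Q" using q by (simp add: region_def)
  have "F (max (t + x1) (rend (l q) (t + x1))) \<le> F (x + t)"
  proof (rule window_min[where \<sigma> = \<sigma>])
    assume "1 \<le> l q"
    hence "1 \<le> q" by (cases "q = 0") (auto simp: l_def)
    thus "\<sigma> (l q) \<le> t + x1" using tstar_eq(1)[of q] q by (simp add: region_def)
  next
    \<comment> \<open>A later ridge that is not skipped has a finite \<open>\<omega>\<close>, so it
      is some \<open>l (k + 1)\<close> with \<open>q < k + 1\<close>, and \<open>tstar_mono\<close>
      puts its crossing time after \<open>t\<close>.\<close>
    fix i assume i: "l q < i" "i \<le> card down_set" "\<not> skipped i (\<sigma> i)"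
    hence "i \<in> set finite_idx" using \<sigma>(2)[of i] by (simp add: set_finite_idx)
    then obtain k where k: "k < Q" "finite_idx ! k = i" by (metis Q_def in_set_conv_nth)
    hence lk: "l (k + 1) = i" by (simp add: l_def)
    have "q < k + 1"
    proof (rule ccontr)
      assume "\<not> q < k + 1"
      hence "l (k + 1) \<le> l q" using l_less[of "k + 1" q] qQ by (cases "k + 1 = q") auto
      thus False using lk i by simp
    qed
    hence "tstar (q + 1) \<le> tstar (k + 1)" "q < Q" using k by (auto intro!: tstar_mono)
    hence "ereal t < tstar (k + 1)" using q by (auto simp: region_def intro: less_le_trans)
    thus "t + x1 < \<sigma> i" using tstar_eq(1)[of "k + 1"] k lk by simp
  qed (use \<sigma> l_le_card qQ assms in \<open>auto simp: L_def\<close>)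
  hence "F (x_circ t + t) \<le> F (x + t)" by (simp only: clamp_eq x_circ_region[OF q])
  thus ?thesis by (simp add: optval_eq F_def algebra_simps)
qed

text \<open>The minimizer at the later \<open>u\<close> is a competitor at \<open>t\<close>, and
  lowering the argument of the nondecreasing \<open>f\<close> cannot raise the value.\<close>

lemma mono_optval: "mono optval"
proof (rule monoI)
  fix t u :: real assume "t \<le> u"
  have "optval t \<le> f (x_circ u + t) + \<nu> * (x2 - x_circ u)" by (intro optval_minimal x_circ_bounds)
  also have "\<dots> \<le> optval u" using monoD[OF mono_f, of "x_circ u + t" "x_circ u + u"] \<open>t \<le> u\<close> by (simp add: optval_eq)
  finally show "optval t \<le> optval u" .
qed

text \<open>Each value is bounded by using the minimizer of the other as a competitor, so they
  differ by at most a small change of \<open>f\<close> under a shift. Jumps of \<open>x_circ\<close>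
  therefore do no harm.\<close>

lemma continuous_optval: "continuous_on UNIV optval"
proof -
  have "isCont optval t" for t
    unfolding continuous_at_eps_delta
  proof (intro allI impI)
    fix e :: real assume e: "0 < e"
    have "uniformly_continuous_on {t + x1 - 1..t + x2 + 1} f"
      by (intro compact_uniformly_continuous continuous_on_subset[OF cont_f]) auto
    then obtain d where d: "0 < d"
      "\<And>y z. y \<in> {t + x1 - 1..t + x2 + 1} \<Longrightarrow> z \<in> {t + x1 - 1..t + x2 + 1} \<Longrightarrow>
        dist z y < d \<Longrightarrow> dist (f z) (f y) < e"
      using e unfolding uniformly_continuous_on_def by metis
    have close: "optval u < optval w + e" if uw: "\<bar>u - t\<bar> < 1" "\<bar>w - t\<bar> < 1" "\<bar>u - w\<bar> < d" for u w
    proof -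
      have "dist (f (x_circ w + u)) (f (x_circ w + w)) < e"
        using uw x_circ_bounds[of w] by (intro d(2)) (auto simp: dist_real_def)
      moreover have "optval u \<le> f (x_circ w + u) + \<nu> * (x2 - x_circ w)" by (intro optval_minimal x_circ_bounds)
      ultimately show ?thesis by (auto simp: optval_eq dist_real_def)
    qed
    have "dist (optval u) (optval t) < e" if "dist u t < min d 1" for u
      using close[of u t] close[of t u] that by (simp add: dist_real_def abs_minus_commute abs_less_iff)
    thus "\<exists>d>0. \<forall>u. dist u t < d \<longrightarrow> dist (optval u) (optval t) < e"
      using d(1) by (intro exI[of _ "min d 1"]) auto
  qed
  thus ?thesis by (simp add: continuous_on_eq_continuous_at)
qed

text \<open>Where \<open>x_circ\<close> has slope \<open>-1\<close>, the argument of
  \<open>f\<close> stays constant and only the ramp changes.\<close>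

lemma optval_slope:
  assumes "has_slope_on x_circ (-1) I"
  shows "has_slope_on optval \<nu> I"
proof -
  obtain c where c: "\<And>t. t \<in> I \<Longrightarrow> x_circ t = - t + c" using assms by (auto simp: has_slope_on_def)
  have "\<forall>t\<in>I. optval t = \<nu> * t + (f c + \<nu> * (x2 - c))" by (simp add: optval_eq c algebra_simps)
  thus ?thesis by (auto simp: has_slope_on_def)
qed

lemma optval_inner:
  assumes "region q t" "x_circ t \<notin> {x1, x2}"
  shows "optval t = \<nu> * t + (f (\<gamma> (a (l q + 1))) - \<nu> * (\<gamma> (a (l q + 1)) - x2))"
proof -
  have eq: "x_circ t = - t + \<gamma> (a (l q + 1))"
    using x_circ_region[OF assms(1)] assms(2) by (auto simp: clamp_def Let_def split: if_splits)
  show ?thesis unfolding optval_eq eq by (simp add: algebra_simps)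
qed

lemma region_last: "tstar Q \<le> ereal t \<Longrightarrow> region Q t"
  by (simp add: region_def)

lemma x_circ_last:
  assumes "l Q = card up_set" "tstar Q \<le> ereal t"
  shows "x_circ t = x2"
  using x_circ_region[OF region_last[OF assms(2)]] assms(1) by (simp add: clamp_def)

section \<open>Piecewise linearity in \<open>t\<close>\<close>

lemma f_shift_affine:
  assumes "is_interval I" "\<And>i. i \<in> {1..M} \<Longrightarrow> \<gamma> i - c \<notin> I"
  shows "\<exists>m k. \<forall>t\<in>I. f (c + t) = m * t + k"
proof (cases "I = {}")
  case False
  then obtain u where u: "u \<in> I" by blast
  obtain p where p: "p \<le> M" "\<Gamma> p \<le> ereal (c + u)" "ereal (c + u) < \<Gamma> (p + 1)" using left_closed_piece .
  obtain k where k: "\<And>x. \<Gamma> p \<le> ereal x \<Longrightarrow> ereal x < \<Gamma> (p + 1) \<Longrightarrow> f x = \<mu> p * x + k"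
    using pl_f p(1) unfolding pl_with_def has_slope_on_def by blast
  have side: "\<Gamma> i \<le> ereal (c + t) \<longleftrightarrow> \<Gamma> i \<le> ereal (c + u)" if "t \<in> I" for i t
    using same_side[OF assms(1) assms(2)[of i] that u] by (auto simp: ext_bp_def algebra_simps)
  have "f (c + t) = \<mu> p * t + (\<mu> p * c + k)" if t: "t \<in> I" for t
    using k[of "c + t"] side[OF t, of p] side[OF t, of "p + 1"] p by (simp add: not_le[symmetric] algebra_simps)
  thus ?thesis by blast
qed simp

text \<open>The formula can change only when an end of the window meets a breakpoint or
  \<open>t\<close> meets some \<open>tstar q\<close>. On an interval free of these times the region
  and the branch of \<open>clamp\<close> are fixed.\<close>

lemma piecewise_linear_optval: "piecewise_linear optval"
proof (rule piecewise_linearI[OF _ continuous_optval])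
  let ?S = "(\<lambda>i. \<gamma> i - x1) ` {1..M} \<union> (\<lambda>i. \<gamma> i - x2) ` {1..M} \<union> (\<lambda>q. real_of_ereal (tstar q)) ` {1..Q}"
  show "finite ?S" by simp
  fix I assume I: "is_interval I" "I \<inter> ?S = {}"
  show "\<exists>m. has_slope_on optval m I"
  proof (cases "I = {}")
    case False
    then obtain u where u: "u \<in> I" by blast
    obtain q where q: "region q u" using region_exists .
    have t_side: "tstar k \<le> ereal t \<longleftrightarrow> tstar k \<le> ereal u" if "t \<in> I" "k \<le> Q" for k t
    proof (cases "k = 0")
      case False
      hence "tstar k = ereal (real_of_ereal (tstar k))" using tstar_eq(1)[of k] that by simp
      moreover have "real_of_ereal (tstar k) \<in> ?S" using False that by auto
      hence "real_of_ereal (tstar k) \<notin> I" using I(2) by blast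
      ultimately show ?thesis using same_side[OF I(1) _ that(1) u] by (metis ereal_less_eq(3))
    qed (simp add: tstar_def)
    have reg: "region q t" if "t \<in> I" for t
      using q t_side[OF that, of q] t_side[OF that, of "q + 1"] by (auto simp: region_def not_le[symmetric])
    have notin: "\<gamma> i - x1 \<notin> I" "\<gamma> i - x2 \<notin> I" if "i \<in> {1..M}" for i using I(2) that by auto
    have "\<exists>m k. \<forall>t\<in>I. optval t = m * t + k"
    proof -
      define G where "G = \<gamma> (a (l q + 1))"
      consider (right) "\<forall>t\<in>I. x_circ t = x2" | (inner) "\<forall>t\<in>I. x_circ t = - t + G"
        | (left) "\<forall>t\<in>I. x_circ t = x1"
      proof (cases "l q < card up_set")
        case True
        hence "a (l q + 1) \<in> {1..M}" using a_in_up_set[of "l q + 1"] by (auto simp: up_set_def)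
        hence G: "G - x1 \<notin> I" "G - x2 \<notin> I" using notin by (auto simp: G_def)
        have xc: "x_circ t = (if u < G - x2 then x2 else if u < G - x1 then - t + G else x1)" if "t \<in> I" for t
        proof -
          have "t < G - x1 \<longleftrightarrow> u < G - x1" "t < G - x2 \<longleftrightarrow> u < G - x2"
            using same_side[OF I(1) G(1) that u] same_side[OF I(1) G(2) that u] by auto
          thus ?thesis using True unfolding x_circ_region[OF reg[OF that]] clamp_def Let_def G_def[symmetric]
            by simp
        qed
        thus thesis using that by (cases "u < G - x2"; cases "u < G - x1") auto
      next
        case False
        thus thesis using that(1) x_circ_region[OF reg] by (simp add: clamp_def)
      qed
      thus ?thesis
      proof cases
        case right
        thus ?thesis using f_shift_affine[OF I(1), of x2] notin by (simp add: optval_eq)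
      next
        case inner
        have "optval t = \<nu> * t + (f G + \<nu> * (x2 - G))" if "t \<in> I" for t
          using bspec[OF inner that] unfolding optval_eq by (simp add: right_diff_distrib)
        thus ?thesis by blast
      next
        case left
        obtain m k where "\<forall>t\<in>I. f (x1 + t) = m * t + k" using f_shift_affine[OF I(1), of x1] notin by auto
        hence "\<forall>t\<in>I. optval t = m * t + (k + \<nu> * (x2 - x1))" using left by (simp add: optval_eq)
        thus ?thesis by blast
      qed
    qed
    thus ?thesis by (simp add: has_slope_on_def)
  qed (simp add: has_slope_on_def)
qed

lemma l_0: "l 0 = 0"
  by (simp add: l_def)

lemma tstar_0: "tstar 0 = -\<infinity>"
  by (simp add: tstar_def)

end

theorem lemma2:
  fixes f xo h :: "real \<Rightarrow> real" and M Q :: nat and \<gamma> \<mu> :: "nat \<Rightarrow> real"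
    and \<nu> x1 x2 :: real and a l :: "nat \<Rightarrow> nat" and tstar :: "nat \<Rightarrow> ereal"
  assumes "M \<ge> 1"
    and "continuous_on UNIV f" and "mono f"
    and "pl_with f M \<gamma> \<mu>"
    and "\<And>i. i < M \<Longrightarrow> \<mu> (i + 1) \<noteq> \<mu> i"
    and "\<And>x. x \<le> \<gamma> 1 \<Longrightarrow> f x = 0"
    and "x1 < x2" and "\<nu> > 0"
    and a_def: "a = pl_setting.a M \<mu> \<nu>"
    and Q_def: "Q = pl_setting.Q M \<gamma> \<mu> \<nu> x1 x2"
    and l_def: "l = pl_setting.l M \<gamma> \<mu> \<nu> x1 x2"
    and tstar_def: "tstar = pl_setting.tstar M \<gamma> \<mu> \<nu> x1 x2"
    and xo_def: "xo = pl_setting.x_circ M \<gamma> \<mu> \<nu> x1 x2"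
    and h_def: "h = (\<lambda>t. f (xo t + t) + ramp x1 x2 \<nu> (xo t))"
  shows "continuous_on UNIV h \<and> mono h \<and> piecewise_linear h \<and>
    (\<forall>t. xo t = x2 \<longrightarrow> h t = f (x2 + t)) \<and>
    (\<forall>I. is_interval I \<and> has_slope_on xo (-1) I \<longrightarrow> has_slope_on h \<nu> I) \<and>
    (\<forall>t. xo t = x1 \<longrightarrow> h t = f (x1 + t) + \<nu> * (x2 - x1)) \<and>
    (Q = 0 \<longrightarrow>
      (\<forall>t. xo t \<notin> {x1, x2} \<longrightarrow> h t = \<nu> * t + (f (\<gamma> (a 1)) - \<nu> * (\<gamma> (a 1) - x2)))) \<and>
    (Q = 1 \<longrightarrow>
      (\<forall>t. ereal t < tstar 1 \<and> xo t \<notin> {x1, x2} \<longrightarrow>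
        h t = \<nu> * t + (f (\<gamma> (a 1)) - \<nu> * (\<gamma> (a 1) - x2))) \<and>
      (\<forall>t. tstar 1 \<le> ereal t \<and> xo t \<notin> {x1, x2} \<longrightarrow>
        h t = \<nu> * t + (f (\<gamma> (a (l Q + 1))) - \<nu> * (\<gamma> (a (l Q + 1)) - x2)))) \<and>
    (Q > 1 \<longrightarrow>
      (\<forall>t. ereal t < tstar 1 \<and> xo t \<notin> {x1, x2} \<longrightarrow>
        h t = \<nu> * t + (f (\<gamma> (a 1)) - \<nu> * (\<gamma> (a 1) - x2))) \<and>
      (\<forall>q\<in>{1..<Q}. \<forall>t. tstar q \<le> ereal t \<and> ereal t < tstar (q + 1) \<and> xo t \<notin> {x1, x2} \<longrightarrow>
        h t = \<nu> * t + (f (\<gamma> (a (l q + 1))) - \<nu> * (\<gamma> (a (l q + 1)) - x2))) \<and>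
      (\<forall>t. tstar Q \<le> ereal t \<and> xo t \<notin> {x1, x2} \<longrightarrow>
        h t = \<nu> * t + (f (\<gamma> (a (l Q + 1))) - \<nu> * (\<gamma> (a (l Q + 1)) - x2)))) \<and>
    (l Q = card (pl_setting.up_set M \<mu> \<nu>) \<longrightarrow>
      (\<forall>t. tstar Q \<le> ereal t \<longrightarrow> xo t \<in> {x1, x2}))"
proof -
  note defs = a_def Q_def l_def tstar_def xo_def
  interpret pl_fun M \<gamma> \<mu> \<nu> x1 x2 f
    using assms(1-4,6-8) by unfold_locales
  have h: "h = optval"
    unfolding h_def defs by (rule ext) (simp add: optval_def)
  \<comment> \<open>Before the first crossing time, and everywhere for \<open>Q = 0\<close>, the
    region is \<open>0\<close> and the valley has number \<open>l 0 + 1 = 1\<close>.\<close>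
  have first: "optval t = \<nu> * t + (f (\<gamma> (pl_setting.a M \<mu> \<nu> 1)) - \<nu> * (\<gamma> (pl_setting.a M \<mu> \<nu> 1) - x2))"
    if "region 0 t" "x_circ t \<notin> {x1, x2}" for t
    using optval_inner[OF that] by (simp add: l_0)
  show ?thesis
    unfolding h defs
    by (intro conjI allI impI ballI; (elim conjE)?;
        (rule continuous_optval mono_optval piecewise_linear_optval
         | (rule optval_slope, assumption)
         | (rule first, (simp add: region_def tstar_0)[1], assumption)
         | (rule optval_inner, (simp add: region_def)[1], assumption)
         | (drule (1) x_circ_last, (simp)[1])
         | (simp add: optval_eq)[1]))
qed

end
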